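(* Let $\mathcal{H}$ be a complex Hilbert space, let $T\in\mathcal{B}(\mathcal{H})$ be a concave operator and let $m,n\ge1$ be integers. Then $T^n$ is a $\Delta_{T^m}$-contraction and $\mathcal{N}(\Delta_T)=\mathcal{N}(\Delta_{T^n})$. Moreover, if $T$ is $\Delta_T$-regular, then the following statements are equivalent: (i) $T^n$ is $\Delta_{T^m}$-regular for every $m,n\ge1$; (ii) the compression $\widehat{T}=P_{\overline{\mathcal{R}(\Delta_T)}}T|_{\overline{\mathcal{R}(\Delta_T)}}$ is quasinormal; (iii) $\widehat{T}$ commutes with $\widehat{Z}^*\widehat{Z}$, where $\widehat{Z}=P_{\mathcal{N}(\Delta_T)}T|_{\overline{\mathcal{R}(\Delta_T)}}$; (iv) the Cauchy dual $T'=T(T^*T)^{-1}$ is a $D_{T'^2}^2$-contraction which is $D_{T'^2}^2$-regular; (v) the compression $T'_0=P_{\overline{\mathcal{R}(\Delta_T)}}T'|_{\overline{\mathcal{R}(\Delta_T)}}$ is quasinormal; (vi) $T'_0$ commutes with $T_1'^*T_1'$, where $T'_1=P_{\mathcal{N}(\Delta_T)}T'|_{\overline{\mathcal{R}(\Delta_T)}}$.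
   Context: For an operator $A$, $\Delta_A=A^*A-I$. $T$ is concave if $T^{*2}T^2-2T^*T+I\le0$ (then $T$ is left invertible and $T'$ is a contraction). For a positive operator $A$, an operator $R$ is an $A$-contraction if $R^*AR\le A$, and is $A$-regular if $AR=A^{1/2}RA^{1/2}$. For a contraction $C$, $D_C^2=I-C^*C$ and $D_C=(I-C^*C)^{1/2}$. An operator $Q$ is quasinormal if $QQ^*Q=Q^*Q^2$. *)

theory Defs
  imports "HOL-Analysis.Analysis"
begin

section \<open>Complex Hilbert spaces\<close>

text \<open>The library has no complex inner product spaces, so we introduce the class of
complex Hilbert spaces: a real Banach space with a compatible complex scalar
multiplication and a complex inner product (linear in the second argument,
conjugate-symmetric) inducing the norm.\<close>

class complex_hilbert = banach +
  fixes scaleC :: "complex \<Rightarrow> 'a \<Rightarrow> 'a"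
    and cinner :: "'a \<Rightarrow> 'a \<Rightarrow> complex"
  assumes scaleC_add_right: "scaleC a (x + y) = scaleC a x + scaleC a y"
    and scaleC_add_left: "scaleC (a + b) x = scaleC a x + scaleC b x"
    and scaleC_scaleC: "scaleC a (scaleC b x) = scaleC (a * b) x"
    and scaleC_one: "scaleC 1 x = x"
    and scaleC_of_real: "scaleC (complex_of_real r) x = scaleR r x"
    and cinner_add_right: "cinner x (y + z) = cinner x y + cinner x z"
    and cinner_scaleC_right: "cinner x (scaleC a y) = a * cinner x y"
    and cinner_commute: "cinner y x = cnj (cinner x y)"
    and norm_eq_sqrt_cinner: "norm x = sqrt (Re (cinner x x))"

section \<open>Bounded operators\<close>

definition clinear :: "('a::complex_hilbert \<Rightarrow> 'b::complex_hilbert) \<Rightarrow> bool" where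
  "clinear f \<longleftrightarrow> (\<forall>x y. f (x + y) = f x + f y) \<and> (\<forall>a x. f (scaleC a x) = scaleC a (f x))"

definition bounded_clinear :: "('a::complex_hilbert \<Rightarrow> 'b::complex_hilbert) \<Rightarrow> bool" where
  "bounded_clinear f \<longleftrightarrow> clinear f \<and> (\<exists>K. \<forall>x. norm (f x) \<le> norm x * K)"

text \<open>Hilbert-space adjoint.\<close>
definition adj :: "('a::complex_hilbert \<Rightarrow> 'a) \<Rightarrow> 'a \<Rightarrow> 'a" where
  "adj T y = (THE z. \<forall>x. cinner (T x) y = cinner x z)"

text \<open>Positivity and the operator order \<open>A \<le> B\<close>.\<close>
definition positive_op :: "('a::complex_hilbert \<Rightarrow> 'a) \<Rightarrow> bool" where
  "positive_op A \<longleftrightarrow> (\<forall>x. Im (cinner x (A x)) = 0 \<and> Re (cinner x (A x)) \<ge> 0)"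

definition op_le :: "('a::complex_hilbert \<Rightarrow> 'a) \<Rightarrow> ('a \<Rightarrow> 'a) \<Rightarrow> bool" where
  "op_le A B \<longleftrightarrow> positive_op (\<lambda>x. B x - A x)"

text \<open>The positive square root of a positive operator.\<close>
definition op_sqrt :: "('a::complex_hilbert \<Rightarrow> 'a) \<Rightarrow> 'a \<Rightarrow> 'a" where
  "op_sqrt A = (THE S. bounded_clinear S \<and> positive_op S \<and> (\<forall>x. S (S x) = A x))"

text \<open>\<open>\<Delta>_A = A^*A - I\<close>.\<close>
definition Delta :: "('a::complex_hilbert \<Rightarrow> 'a) \<Rightarrow> 'a \<Rightarrow> 'a" where
  "Delta A = (\<lambda>x. adj A (A x) - x)"

text \<open>Concave: \<open>T^{*2}T^2 - 2T^*T + I \<le> 0\<close>.\<close>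
definition concave_op :: "('a::complex_hilbert \<Rightarrow> 'a) \<Rightarrow> bool" where
  "concave_op T \<longleftrightarrow>
     op_le (\<lambda>x. adj T (adj T (T (T x))) - 2 *\<^sub>R adj T (T x) + x) (\<lambda>x. 0)"

definition A_contraction :: "('a::complex_hilbert \<Rightarrow> 'a) \<Rightarrow> ('a \<Rightarrow> 'a) \<Rightarrow> bool" where
  "A_contraction A R \<longleftrightarrow> op_le (\<lambda>x. adj R (A (R x))) A"

definition A_regular :: "('a::complex_hilbert \<Rightarrow> 'a) \<Rightarrow> ('a \<Rightarrow> 'a) \<Rightarrow> bool" where
  "A_regular A R \<longleftrightarrow> (\<forall>x. A (R x) = op_sqrt A (R (op_sqrt A x)))"

text \<open>\<open>D_C^2 = I - C^*C\<close>.\<close>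
definition DC2 :: "('a::complex_hilbert \<Rightarrow> 'a) \<Rightarrow> 'a \<Rightarrow> 'a" where
  "DC2 C = (\<lambda>x. x - adj C (C x))"

text \<open>Cauchy dual \<open>T' = T(T^*T)^{-1}\<close>.\<close>
definition cauchy_dual :: "('a::complex_hilbert \<Rightarrow> 'a) \<Rightarrow> 'a \<Rightarrow> 'a" where
  "cauchy_dual T = (\<lambda>x. T (inv (\<lambda>y. adj T (T y)) x))"

definition ker_op :: "('a::complex_hilbert \<Rightarrow> 'a) \<Rightarrow> 'a set" where
  "ker_op A = {x. A x = 0}"

text \<open>Orthogonal projection onto a closed subspace \<open>M\<close>.\<close>
definition proj :: "'a::complex_hilbert set \<Rightarrow> 'a \<Rightarrow> 'a" where
  "proj M x = (THE y. y \<in> M \<and> (\<forall>z\<in>M. cinner z (x - y) = 0))"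

text \<open>Adjoint of an operator \<open>Q\<close> defined on the closed subspace \<open>M\<close> (with values in
  the ambient space): the vector \<open>Q^* y \<in> M\<close> with \<open>\<langle>Qx,y\<rangle> = \<langle>x,Q^*y\<rangle>\<close> for all \<open>x \<in> M\<close>.\<close>
definition adj_on :: "'a::complex_hilbert set \<Rightarrow> ('a \<Rightarrow> 'a) \<Rightarrow> 'a \<Rightarrow> 'a" where
  "adj_on M Q y = (THE z. z \<in> M \<and> (\<forall>x\<in>M. cinner (Q x) y = cinner x z))"

text \<open>Quasinormality \<open>QQ^*Q = Q^*Q^2\<close> of an operator \<open>Q\<close> on the Hilbert space \<open>M\<close>.\<close>
definition quasinormal_on :: "'a::complex_hilbert set \<Rightarrow> ('a \<Rightarrow> 'a) \<Rightarrow> bool" where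
  "quasinormal_on M Q \<longleftrightarrow> (\<forall>x\<in>M. Q (adj_on M Q (Q x)) = adj_on M Q (Q (Q x)))"

end

theory Submission
  imports Defs
begin

text \<open>For a concave \<open>T\<close> the sequence \<open>\<parallel>T\<^sup>n x\<parallel>\<^sup>2\<close> is concave and bounded below, hence nondecreasing with
  nonincreasing increments; this gives the contractivity and kernel claims.

  A positive operator \<open>A\<close> satisfies \<open>A R = A\<^sup>1\<^sup>/\<^sup>2 R A\<^sup>1\<^sup>/\<^sup>2\<close> if and only if \<open>A\<^sup>2 R = A R A\<close>, which removes
  the square roots. With \<open>A = \<Delta>\<^sub>T\<close>, regularity of \<open>T\<close> says that the compression \<open>W\<close> of \<open>T\<close> to the
  closed range of \<open>A\<close> vanishes on the kernel of \<open>A\<close> and commutes with \<open>A\<close>, hence also with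
  \<open>G = (T\<^sup>*T)\<^sup>-\<^sup>1 = (I + A)\<^sup>-\<^sup>1\<close>. In terms of \<open>W\<close>, \<open>A\<close> and \<open>G\<close> one has \<open>Z\<^sup>*Z = I + A - W\<^sup>*W\<close>,
  \<open>T'\<^sub>0 = W G\<close>, \<open>\<Delta> (T\<^sup>2) = A (I + W\<^sup>*W)\<close> and \<open>I - T'\<^sup>*\<^sup>2 T'\<^sup>2 = A G (I + G\<^sup>2 W\<^sup>*W)\<close>. As \<open>A\<close> and \<open>G\<close>
  are injective on the closed range of \<open>A\<close>, each of the six conditions reduces to
  \<open>W W\<^sup>* W = W\<^sup>* W W\<close>.\<close>

section \<open>Inner products and bounded operators\<close>

lemma cinner_add_left: "cinner (x + y) z = cinner x z + cinner y (z::'a::complex_hilbert)"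
  by (metis cinner_add_right cinner_commute complex_cnj_add)

lemma cinner_scaleC_left: "cinner (scaleC a x) y = cnj a * cinner x (y::'a::complex_hilbert)"
  by (metis cinner_commute cinner_scaleC_right complex_cnj_mult)

lemma cinner_scaleR_right: "cinner x (r *\<^sub>R y) = complex_of_real r * cinner x (y::'a::complex_hilbert)"
  by (metis cinner_scaleC_right scaleC_of_real)

lemma cinner_scaleR_left: "cinner (r *\<^sub>R x) y = complex_of_real r * cinner x (y::'a::complex_hilbert)"
  by (metis cinner_scaleC_left complex_cnj_complex_of_real scaleC_of_real)

lemma cinner_zero_right [simp]: "cinner x (0::'a::complex_hilbert) = 0"
  using cinner_add_right[of x 0 0] by simp

lemma cinner_zero_left [simp]: "cinner (0::'a::complex_hilbert) x = 0"
  using cinner_add_left[of 0 0 x] by simp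

lemma cinner_minus_right: "cinner x (- y) = - cinner x (y::'a::complex_hilbert)"
  using cinner_scaleR_right[of x "-1" y] by simp

lemma cinner_minus_left: "cinner (- x) y = - cinner x (y::'a::complex_hilbert)"
  using cinner_scaleR_left[of "-1" x y] by simp

lemma cinner_diff_right: "cinner x (y - z) = cinner x y - cinner x (z::'a::complex_hilbert)"
  using cinner_add_right[of x y "- z"] by (simp add: cinner_minus_right)

lemma cinner_diff_left: "cinner (x - y) z = cinner x z - cinner y (z::'a::complex_hilbert)"
  using cinner_add_left[of x "- y" z] by (simp add: cinner_minus_left)

lemma cinner_self: "cinner x x = complex_of_real ((norm (x::'a::complex_hilbert))\<^sup>2)"
proof -
  have "Im (cinner x x) = 0"
    using arg_cong[OF cinner_commute[of x x], of Im] by simp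
  \<comment> \<open>Since \<open>sqrt\<close> is odd on the reals, a nonnegative norm forces a
    nonnegative radicand.\<close>
  moreover have "Re (cinner x x) \<ge> 0"
    by (metis norm_eq_sqrt_cinner norm_ge_zero real_sqrt_ge_0_iff)
  ultimately show ?thesis
    by (simp add: complex_eq_iff norm_eq_sqrt_cinner)
qed

lemma Re_cinner_commute: "Re (cinner y x) = Re (cinner x (y::'a::complex_hilbert))"
  using arg_cong[OF cinner_commute[of y x], of Re] by simp

lemma norm_add_sq:
  "(norm (x + y))\<^sup>2 = (norm x)\<^sup>2 + 2 * Re (cinner x y) + (norm (y::'a::complex_hilbert))\<^sup>2"
proof -
  have "complex_of_real ((norm (x + y))\<^sup>2) = cinner (x + y) (x + y)"
    by (simp only: cinner_self)
  then have "(norm (x + y))\<^sup>2 = Re (cinner (x + y) (x + y))"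
    by (metis Re_complex_of_real)
  also have "\<dots> = Re (cinner x x) + Re (cinner x y) + Re (cinner y x) + Re (cinner y y)"
    by (simp only: cinner_add_left cinner_add_right plus_complex.simps add_ac)
  finally show ?thesis
    using Re_cinner_commute[of y x] by (simp add: cinner_self)
qed

text \<open>The triangle inequality comes with the norm of the class, so squaring it yields this
  half of Cauchy-Schwarz, the reverse of the usual order.\<close>

lemma Re_cinner_le: "Re (cinner x y) \<le> norm x * norm (y::'a::complex_hilbert)"
proof -
  have "(norm (x + y))\<^sup>2 \<le> (norm x + norm y)\<^sup>2"
    by (simp add: norm_triangle_ineq power_mono)
  then show ?thesis
    by (simp add: norm_add_sq power2_sum)
qed

section \<open>Complex scalars and the Cauchy-Schwarz inequality\<close>

lemma scaleC_zero_right [simp]: "scaleC a (0::'a::complex_hilbert) = 0"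
  using scaleC_add_right[of a 0 0] by simp

lemma scaleC_minus_right: "scaleC a (- x) = - scaleC a (x::'a::complex_hilbert)"
  using scaleC_add_right[of a x "- x"] by (simp add: add_eq_0_iff)

lemma scaleC_diff_right: "scaleC a (x - y) = scaleC a x - scaleC a (y::'a::complex_hilbert)"
  using scaleC_add_right[of a x "- y"] by (simp add: scaleC_minus_right)

lemma scaleC_scaleR_right: "scaleC a (r *\<^sub>R x) = r *\<^sub>R scaleC a (x::'a::complex_hilbert)"
  by (metis mult.commute scaleC_of_real scaleC_scaleC)

lemma norm_scaleC: "norm (scaleC a x) = cmod a * norm (x::'a::complex_hilbert)"
proof -
  have "complex_of_real ((norm (scaleC a x))\<^sup>2) = cnj a * (a * complex_of_real ((norm x)\<^sup>2))"
    by (simp only: cinner_self[symmetric] cinner_scaleC_left cinner_scaleC_right mult_ac)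
  also have "\<dots> = complex_of_real ((cmod a * norm x)\<^sup>2)"
    using complex_norm_square[of a] by (simp add: power_mult_distrib mult_ac)
  finally have "(norm (scaleC a x))\<^sup>2 = (cmod a * norm x)\<^sup>2"
    using of_real_eq_iff by blast
  then show ?thesis
    by (simp add: power2_eq_iff_nonneg)
qed

lemma bounded_linear_scaleC: "bounded_linear (scaleC a :: 'a \<Rightarrow> 'a::complex_hilbert)"
proof
  show "\<exists>K. \<forall>x::'a. norm (scaleC a x) \<le> norm x * K"
    by (metis norm_scaleC mult.commute order_refl)
qed (simp_all add: scaleC_add_right scaleC_scaleR_right)

text \<open>Rotating \<open>y\<close> by a unimodular scalar makes the inner product real and
  nonnegative, which reduces the claim to the bound on real parts.\<close>

lemma norm_cinner_le: "cmod (cinner x y) \<le> norm x * norm (y::'a::complex_hilbert)"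
proof (cases "cinner x y = 0")
  case False
  define a where "a = cnj (cinner x y) / cmod (cinner x y)"
  have a: "cmod a = 1"
    using False by (simp add: a_def norm_divide)
  have "Re (cinner x (scaleC a y)) = cmod (cinner x y)"
    using False by (simp add: cinner_scaleC_right a_def complex_norm_square[symmetric] mult.commute
        power2_eq_square)
  then show ?thesis
    using Re_cinner_le[of x "scaleC a y"] by (simp add: norm_scaleC a)
qed auto

lemma bounded_linear_cinner_right: "bounded_linear (cinner (x::'a::complex_hilbert))"
proof
  show "\<exists>K. \<forall>y. cmod (cinner x y) \<le> norm y * K"
    by (metis mult.commute norm_cinner_le)
qed (simp_all add: cinner_add_right cinner_scaleR_right scaleR_conv_of_real)

lemma cinner_ext: "x = y" if "\<And>z. cinner z x = cinner z (y::'a::complex_hilbert)"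
proof -
  have "cinner (x - y) (x - y) = 0"
    using that by (simp add: cinner_diff_right)
  then show ?thesis
    by (simp add: cinner_self)
qed

section \<open>Complex-linear maps and bounded operators\<close>

lemma clinear_add: "clinear f \<Longrightarrow> f (x + y) = f x + f y"
  by (simp add: clinear_def)

lemma clinear_scaleC: "clinear f \<Longrightarrow> f (scaleC a x) = scaleC a (f x)"
  by (simp add: clinear_def)

lemma clinear_scaleR: "clinear f \<Longrightarrow> f (r *\<^sub>R x) = r *\<^sub>R f x"
  by (metis clinear_scaleC scaleC_of_real)

lemma clinear_zero: "clinear f \<Longrightarrow> f 0 = 0"
  using clinear_scaleR[of f 0 0] by simp

lemma clinear_minus: "clinear f \<Longrightarrow> f (- x) = - f x"
  using clinear_scaleR[of f "-1" x] by simp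

lemma clinear_diff: "clinear f \<Longrightarrow> f (x - y) = f x - f y"
  using clinear_add[of f x "- y"] by (simp add: clinear_minus)

lemma bounded_clinear_clinear: "bounded_clinear f \<Longrightarrow> clinear f"
  by (simp add: bounded_clinear_def)

lemma bounded_clinear_bounded_linear: "bounded_linear f" if "bounded_clinear f"
proof
  show "\<exists>K. \<forall>x. norm (f x) \<le> norm x * K"
    using that by (simp add: bounded_clinear_def)
qed (use that in \<open>auto simp: clinear_add clinear_scaleR bounded_clinear_def\<close>)

lemma bounded_clinear_iff: "bounded_clinear f \<longleftrightarrow> clinear f \<and> bounded_linear f"
  using bounded_clinear_bounded_linear[of f] bounded_linear.bounded[of f]
  unfolding bounded_clinear_def by blast

lemmas bcl_add = clinear_add[OF bounded_clinear_clinear]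
  and bcl_diff = clinear_diff[OF bounded_clinear_clinear]
  and bcl_scaleR = clinear_scaleR[OF bounded_clinear_clinear]
  and bcl_scaleC = clinear_scaleC[OF bounded_clinear_clinear]
  and bcl_zero = clinear_zero[OF bounded_clinear_clinear]

lemma bounded_clinear_ident: "bounded_clinear (\<lambda>x::'a::complex_hilbert. x)"
  by (simp add: bounded_clinear_iff clinear_def bounded_linear_ident)

lemma bounded_clinear_compose:
  "bounded_clinear f \<Longrightarrow> bounded_clinear g \<Longrightarrow> bounded_clinear (\<lambda>x. f (g x))"
  unfolding bounded_clinear_iff clinear_def by (intro conjI bounded_linear_compose[of f g]) auto

lemma bounded_clinear_add:
  "bounded_clinear f \<Longrightarrow> bounded_clinear g \<Longrightarrow> bounded_clinear (\<lambda>x. f x + g x)"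
  unfolding bounded_clinear_iff clinear_def
  by (intro conjI bounded_linear_add) (auto simp: scaleC_add_right)

lemma bounded_clinear_diff:
  "bounded_clinear f \<Longrightarrow> bounded_clinear g \<Longrightarrow> bounded_clinear (\<lambda>x. f x - g x)"
  unfolding bounded_clinear_iff clinear_def
  by (intro conjI bounded_linear_sub) (auto simp: scaleC_diff_right)

lemma bounded_clinear_scaleR:
  "bounded_clinear f \<Longrightarrow> bounded_clinear (\<lambda>x. r *\<^sub>R f x)"
  unfolding bounded_clinear_iff clinear_def
  by (intro conjI bounded_linear_const_scaleR) (auto simp: scaleR_add_right scaleC_scaleR_right)

lemma bounded_clinear_funpow: "bounded_clinear (f ^^ n)" if "bounded_clinear (f::'a::complex_hilbert \<Rightarrow> 'a)"
proof (induction n)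
  case 0
  then show ?case using bounded_clinear_ident by (simp add: id_def)
next
  case (Suc n)
  then show ?case using bounded_clinear_compose[OF that] by (simp add: o_def)
qed

section \<open>Riesz representation, adjoints and orthogonal projections\<close>

definition closed_csubspace :: "'a::complex_hilbert set \<Rightarrow> bool" where
  "closed_csubspace M \<longleftrightarrow> closed M \<and> 0 \<in> M \<and> (\<forall>x\<in>M. \<forall>y\<in>M. x + y \<in> M) \<and> (\<forall>a. \<forall>x\<in>M. scaleC a x \<in> M)"

lemma closed_csubspaceD:
  assumes "closed_csubspace M"
  shows "closed M" "0 \<in> M" "x \<in> M \<Longrightarrow> y \<in> M \<Longrightarrow> x + y \<in> M" "x \<in> M \<Longrightarrow> scaleC a x \<in> M"
    "x \<in> M \<Longrightarrow> r *\<^sub>R x \<in> M" "x \<in> M \<Longrightarrow> y \<in> M \<Longrightarrow> x - y \<in> M"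
proof -
  show *: "closed M" "0 \<in> M" "x \<in> M \<Longrightarrow> y \<in> M \<Longrightarrow> x + y \<in> M" "\<And>a x. x \<in> M \<Longrightarrow> scaleC a x \<in> M" for x y
    using assms by (auto simp: closed_csubspace_def)
  show R: "x \<in> M \<Longrightarrow> r *\<^sub>R x \<in> M" for r x
    by (metis *(4) scaleC_of_real)
  show "x \<in> M \<Longrightarrow> y \<in> M \<Longrightarrow> x - y \<in> M"
    using *(3)[of x "(-1) *\<^sub>R y"] R[of y "-1"] by simp
qed

lemma closed_csubspace_UNIV: "closed_csubspace UNIV"
  by (simp add: closed_csubspace_def)

text \<open>First-order condition at a minimum, used for the variational characterisation of the
  Riesz vector.\<close>

lemma linear_term_zero:
  fixes c d :: real
  assumes "\<And>t. 0 \<le> t\<^sup>2 * c + 2 * t * d"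
  shows "d = 0"
proof (rule ccontr)
  assume "d \<noteq> 0"
  \<comment> \<open>The denominator is positive even for \<open>c = 0\<close> and large enough that
    the quadratic term cannot compensate the linear one.\<close>
  define t where "t = - d / (\<bar>c\<bar> + 1)"
  have "t\<^sup>2 * c + 2 * t * d = d\<^sup>2 / (\<bar>c\<bar> + 1) * (c / (\<bar>c\<bar> + 1) - 2)"
    unfolding t_def by (simp add: power2_eq_square right_diff_distrib)
  moreover have "c / (\<bar>c\<bar> + 1) - 2 < 0"
    by (simp add: divide_less_eq) linarith
  moreover have "d\<^sup>2 / (\<bar>c\<bar> + 1) > 0"
    using \<open>d \<noteq> 0\<close> by (simp add: add_nonneg_pos)
  ultimately have "t\<^sup>2 * c + 2 * t * d < 0"
    by (simp only: mult_pos_neg)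
  then show False
    using assms[of t] by linarith
qed

text \<open>The representing vector minimises \<open>x \<mapsto> \<parallel>x\<parallel>\<^sup>2 - 2 Re (f x)\<close> on \<open>M\<close>.\<close>

lemma Riesz_closed_csubspace:
  fixes f :: "'a::complex_hilbert \<Rightarrow> complex"
  assumes M: "closed_csubspace M" and f: "bounded_linear f"
    and fC: "\<And>a x. f (scaleC a x) = a * f x"
  shows "\<exists>z\<in>M. \<forall>x\<in>M. f x = cinner z x"
proof -
  interpret f: bounded_linear f by fact
  note MD = closed_csubspaceD[OF M]
  obtain K where K: "\<And>x. cmod (f x) \<le> norm x * K"
    using f.bounded by blast
  define q where "q x = (norm x)\<^sup>2 - 2 * Re (f x)" for x
  have lb: "- K\<^sup>2 \<le> q x" for x
  proof -
    have "Re (f x) \<le> norm x * K"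
      using K[of x] complex_Re_le_cmod[of "f x"] by linarith
    moreover have "0 \<le> (norm x - K)\<^sup>2" by simp
    ultimately show ?thesis
      by (simp add: q_def power2_diff)
  qed
  define m where "m = Inf (q ` M)"
  have bdd: "bdd_below (q ` M)"
    using lb by (auto intro!: bdd_belowI2)
  have m_le: "m \<le> q x" if "x \<in> M" for x
    unfolding m_def using that bdd by (simp add: cINF_lower)
  have "\<exists>x\<in>M. q x < m + 1 / Suc n" for n :: nat
    using cInf_lessD[of "q ` M" "m + 1 / Suc n"] MD(2) by (auto simp: m_def[symmetric])
  then obtain X where XM: "\<And>n::nat. X n \<in> M" and Xq: "\<And>n. q (X n) < m + 1 / Suc n"
    by metis
  \<comment> \<open>Parallelogram law for \<open>q\<close>: the linear parts cancel. As the midpoint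
    of two points of \<open>M\<close> lies in \<open>M\<close>, minimising sequences are
    Cauchy.\<close>
  have par: "(norm (x - y))\<^sup>2 = 2 * q x + 2 * q y - 4 * q ((1/2) *\<^sub>R (x + y))" for x y
  proof -
    have "(norm (x - y))\<^sup>2 = (norm x)\<^sup>2 - 2 * Re (cinner x y) + (norm y)\<^sup>2"
      using norm_add_sq[of x "- y"] by (simp add: cinner_minus_right)
    moreover have "4 * (norm ((1/2) *\<^sub>R (x + y)))\<^sup>2 = (norm (x + y))\<^sup>2"
      by (simp add: power2_eq_square)
    ultimately show ?thesis
      by (simp add: q_def norm_add_sq f.scaleR f.add field_simps)
  qed
  have dist: "(norm (X i - X j))\<^sup>2 \<le> 2 / Suc i + 2 / Suc j" for i j
    using Xq[of i] Xq[of j] m_le[OF MD(5)[OF MD(3)[OF XM XM]], of "1/2" i j] par[of "X i" "X j"]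
    by simp
  have "Cauchy X"
  proof (rule CauchyI)
    fix e :: real assume "0 < e"
    then obtain k :: nat where k: "4 / e\<^sup>2 < real k"
      using reals_Archimedean2 by blast
    have "norm (X i - X j) < e" if "k \<le> i" "k \<le> j" for i j
    proof -
      have k0: "k > 0" using k \<open>0 < e\<close>
        by (intro gr0I) (auto simp: divide_less_0_iff)
      have "2 / real (Suc i) \<le> 2 / real k" "2 / real (Suc j) \<le> 2 / real k"
        using that k0 by (auto intro!: divide_left_mono)
      then have "(norm (X i - X j))\<^sup>2 \<le> 4 / real k"
        using dist[of i j] by simp
      also have "\<dots> < e\<^sup>2"
        using k k0 \<open>0 < e\<close> by (simp add: field_simps)
      finally show ?thesis
        using \<open>0 < e\<close> by (simp add: power2_less_imp_less)
    qed
    then show "\<exists>k. \<forall>i\<ge>k. \<forall>j\<ge>k. norm (X i - X j) < e" by blast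
  qed
  then obtain z where z: "X \<longlonglongrightarrow> z"
    using Cauchy_convergent convergent_def by blast
  have zM: "z \<in> M"
    using MD(1) XM z closed_sequentially by blast
  have "(\<lambda>n. q (X n)) \<longlonglongrightarrow> q z"
    unfolding q_def by (intro tendsto_intros f.tendsto z)
  moreover have "(\<lambda>n. m + 1 / Suc n) \<longlonglongrightarrow> m + 0"
    by (intro tendsto_intros LIMSEQ_Suc[OF lim_1_over_n])
  ultimately have qz: "q z \<le> m"
    using Xq by (intro LIMSEQ_le[of "\<lambda>n. q (X n)" _ "\<lambda>n. m + 1 / Suc n"]) (auto intro: less_imp_le)
  have Re_eq: "Re (f x) = Re (cinner z x)" if "x \<in> M" for x
  proof -
    have "0 \<le> t\<^sup>2 * (norm x)\<^sup>2 + 2 * t * (Re (cinner z x) - Re (f x))" for t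
    proof -
      have "q z \<le> q (z + t *\<^sub>R x)"
        using qz m_le[OF MD(3)[OF zM MD(5)[OF that]]] by (rule order_trans)
      then show ?thesis
        by (simp add: q_def norm_add_sq f.add f.scaleR cinner_scaleR_right power_mult_distrib algebra_simps)
    qed
    from linear_term_zero[OF this] show ?thesis by simp
  qed
  have "f x = cinner z x" if "x \<in> M" for x
  proof -
    \<comment> \<open>The imaginary part of a complex-linear functional at \<open>x\<close> is minus
      its real part at \<open>\<i>\<close> times \<open>x\<close>.\<close>
    have "Im (f x) = Im (cinner z x)"
      using Re_eq[OF MD(4)[OF that, of \<i>]] by (simp add: fC cinner_scaleC_right)
    with Re_eq[OF that] show ?thesis
      by (simp add: complex_eq_iff)
  qed
  with zM show ?thesis by blast
qed

lemma closed_csubspace_cinner_unique: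
  assumes "closed_csubspace M" "y \<in> M" "z \<in> M" "\<And>x. x \<in> M \<Longrightarrow> cinner x y = cinner x z"
  shows "y = z"
proof -
  have "cinner (y - z) (y - z) = 0"
    using assms(4)[OF closed_csubspaceD(6)[OF assms(1-3)]] by (simp add: cinner_diff_right)
  then show ?thesis by (simp add: cinner_self)
qed

section \<open>Existence and calculus of adjoints\<close>

lemma bounded_linear_cinner_apply:
  "bounded_clinear F \<Longrightarrow> bounded_linear (\<lambda>x. cinner y (F x))"
  by (intro bounded_linear_compose[OF bounded_linear_cinner_right] bounded_clinear_bounded_linear)

text \<open>Riesz applied to \<open>\<lambda>x. cinner y (F x)\<close> gives existence, and testing
  against vectors of \<open>M\<close> gives uniqueness, so the definite description is
  justified.\<close>

lemma adj_on_works: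
  assumes "closed_csubspace M" "bounded_clinear F"
  shows "adj_on M F y \<in> M \<and> (\<forall>x\<in>M. cinner (F x) y = cinner x (adj_on M F y))"
proof -
  obtain z where z: "z \<in> M" "\<forall>x\<in>M. cinner y (F x) = cinner z x"
    using Riesz_closed_csubspace[OF assms(1) bounded_linear_cinner_apply[OF assms(2)]] assms(2)
    by (auto simp: bcl_scaleC cinner_scaleC_right)
  then have z': "\<forall>x\<in>M. cinner (F x) y = cinner x z"
    by (metis cinner_commute)
  show ?thesis
    unfolding adj_on_def
  proof (rule theI[of _ z])
    fix w assume "w \<in> M \<and> (\<forall>x\<in>M. cinner (F x) y = cinner x w)"
    then show "w = z"
      using z z' by (intro closed_csubspace_cinner_unique[OF assms(1)]) auto
  qed (use z z' in blast)
qed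

lemma adj_on_eqI:
  assumes "closed_csubspace M" "z \<in> M" "\<And>x. x \<in> M \<Longrightarrow> cinner (F x) y = cinner x z"
  shows "adj_on M F y = z"
  unfolding adj_on_def
proof (rule the_equality)
  fix w assume "w \<in> M \<and> (\<forall>x\<in>M. cinner (F x) y = cinner x w)"
  then show "w = z"
    using assms by (intro closed_csubspace_cinner_unique[OF assms(1)]) auto
qed (use assms in blast)

lemma adj_eq_adj_on: "adj F y = adj_on UNIV F y"
  by (simp add: adj_on_def adj_def)

lemma cinner_adj: "bounded_clinear F \<Longrightarrow> cinner x (adj F y) = cinner (F x) y"
  using adj_on_works[OF closed_csubspace_UNIV, of F y] by (simp only: adj_eq_adj_on UNIV_I ball_simps)

lemma cinner_adj_left: "bounded_clinear F \<Longrightarrow> cinner (adj F y) x = cinner y (F x)"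
  by (metis cinner_adj cinner_commute)

lemma adj_eqI:
  assumes "\<And>x y. cinner (F x) y = cinner x (F' y)"
  shows "adj F = F'"
proof
  fix y
  show "adj F y = F' y"
    unfolding adj_eq_adj_on by (rule adj_on_eqI[OF closed_csubspace_UNIV]) (simp_all add: assms)
qed

lemma bounded_clinear_adj:
  assumes F: "bounded_clinear F"
  shows "bounded_clinear (adj F)"
proof -
  have "clinear (adj F)"
    unfolding clinear_def
    by (intro conjI allI cinner_ext) (simp_all add: cinner_adj[OF F] cinner_add_right cinner_scaleC_right)
  moreover obtain K where K: "\<And>x. norm (F x) \<le> norm x * K" "K \<ge> 0"
    using bounded_linear.nonneg_bounded[OF bounded_clinear_bounded_linear[OF F]] by blast
  have "norm (adj F y) \<le> norm y * K" for y
  proof -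
    have "complex_of_real ((norm (adj F y))\<^sup>2) = cinner (F (adj F y)) y"
      by (simp only: cinner_self[symmetric] cinner_adj[OF F])
    then have "(norm (adj F y))\<^sup>2 = Re (cinner (F (adj F y)) y)"
      by (metis Re_complex_of_real)
    also have "\<dots> \<le> (norm (adj F y) * K) * norm y"
      using Re_cinner_le K by (meson mult_right_mono norm_ge_zero order_trans)
    finally have "norm (adj F y) * norm (adj F y) \<le> norm (adj F y) * (norm y * K)"
      by (simp add: power2_eq_square mult_ac)
    then show ?thesis
      using K(2) by (cases "adj F y = 0") auto
  qed
  ultimately show ?thesis
    unfolding bounded_clinear_def by blast
qed

lemma adj_compose:
  assumes "bounded_clinear F" "bounded_clinear F'"
  shows "adj (\<lambda>x. F (F' x)) = (\<lambda>x. adj F' (adj F x))"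
  by (rule adj_eqI) (simp add: assms cinner_adj)

text \<open>The orthogonal projection is the adjoint of the inclusion of \<open>M\<close>, so its
  existence needs no separate argument.\<close>

lemma proj_eq_adj_on: "proj M x = adj_on M (\<lambda>x. x) x"
  by (auto simp: proj_def adj_on_def cinner_diff_right)

lemma proj_works:
  assumes "closed_csubspace M"
  shows "proj M x \<in> M \<and> (\<forall>z\<in>M. cinner z (x - proj M x) = 0)"
  using adj_on_works[OF assms bounded_clinear_ident, of x]
  by (simp add: cinner_diff_right proj_eq_adj_on)

lemma proj_eqI:
  assumes "closed_csubspace M" "y \<in> M" "\<And>z. z \<in> M \<Longrightarrow> cinner z (x - y) = 0"
  shows "proj M x = y"
  unfolding proj_eq_adj_on
  by (rule adj_on_eqI[OF assms(1,2)]) (use assms(3) in \<open>simp add: cinner_diff_right\<close>)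

lemma proj_in: "closed_csubspace M \<Longrightarrow> proj M x \<in> M"
  by (simp add: proj_works)

lemma proj_ident: "closed_csubspace M \<Longrightarrow> x \<in> M \<Longrightarrow> proj M x = x"
  by (simp add: proj_eqI)

lemma cinner_proj: "closed_csubspace M \<Longrightarrow> z \<in> M \<Longrightarrow> cinner z (proj M x) = cinner z x"
  using proj_works[of M x] by (simp add: cinner_diff_right)

lemma cinner_proj_left: "closed_csubspace M \<Longrightarrow> z \<in> M \<Longrightarrow> cinner (proj M x) z = cinner x z"
  by (metis cinner_proj cinner_commute)

lemma cinner_proj_swap: "closed_csubspace M \<Longrightarrow> cinner (proj M x) y = cinner x (proj M y)"
  by (metis cinner_proj cinner_proj_left proj_in)

lemma bounded_clinear_proj:
  assumes M: "closed_csubspace M"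
  shows "bounded_clinear (proj M)"
proof -
  have "proj M (x + y) = proj M x + proj M y" for x y
    by (rule proj_eqI[OF M]) (simp_all add: closed_csubspaceD(3)[OF M] proj_in[OF M]
        cinner_add_right cinner_diff_right cinner_proj[OF M])
  moreover have "proj M (scaleC a x) = scaleC a (proj M x)" for a x
    by (rule proj_eqI[OF M]) (simp_all add: closed_csubspaceD(4)[OF M] proj_in[OF M]
        cinner_scaleC_right cinner_diff_right cinner_proj[OF M])
  ultimately have "clinear (proj M)"
    by (simp add: clinear_def)
  moreover have "norm (proj M x) \<le> norm x * 1" for x
  proof -
    have "(norm x)\<^sup>2 = (norm (proj M x))\<^sup>2 + (norm (x - proj M x))\<^sup>2"
      using norm_add_sq[of "proj M x" "x - proj M x"] proj_works[OF M, of x] by simp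
    then have "(norm (proj M x))\<^sup>2 \<le> (norm x)\<^sup>2"
      by simp
    then show ?thesis
      by (simp add: power2_le_iff_abs_le)
  qed
  ultimately show ?thesis
    unfolding bounded_clinear_def by blast
qed

section \<open>Positive operators and their square roots\<close>

lemma Re_cinner_self: "Re (cinner x x) = (norm (x::'a::complex_hilbert))\<^sup>2"
  by (simp add: cinner_self)

text \<open>Polarisation: the quadratic form is real at \<open>x + y\<close> and at
  \<open>x + scaleC \<i> y\<close>, which fixes the imaginary and the real part.\<close>

lemma positive_op_selfadjoint:
  assumes A: "clinear A" and pos: "positive_op A"
  shows "cinner (A x) y = cinner x (A y)"
proof -
  have im: "Im (cinner z (A z)) = 0" for z
    using pos by (simp add: positive_op_def)
  have "Im (cinner x (A y)) + Im (cinner y (A x)) = 0"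
    using im[of "x + y"] im[of x] im[of y]
    by (simp add: clinear_add[OF A] cinner_add_left cinner_add_right)
  moreover have "Re (cinner x (A y)) - Re (cinner y (A x)) = 0"
    using im[of "x + scaleC \<i> y"] im[of x] im[of y]
    by (simp add: clinear_add[OF A] clinear_scaleC[OF A] cinner_add_left cinner_add_right
        cinner_scaleC_left cinner_scaleC_right)
  ultimately have "cinner x (A y) = cnj (cinner y (A x))"
    by (simp add: complex_eq_iff)
  then show ?thesis
    by (metis cinner_commute)
qed

text \<open>This is A^2 \<le> K A, obtained without square roots by evaluating the form of
  \<open>A\<close> at \<open>x - (1/K) *\<^sub>R A x\<close>.\<close>

lemma positive_op_norm_sq_le:
  assumes A: "clinear A" and pos: "positive_op A" and K: "K > 0" "\<And>x. norm (A x) \<le> norm x * K"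
  shows "(norm (A x))\<^sup>2 \<le> K * Re (cinner x (A x))"
proof -
  define z where "z = x - (1/K) *\<^sub>R A x"
  have "Re (cinner (A x) (A (A x))) \<le> norm (A x) * (norm (A x) * K)"
    using Re_cinner_le[of "A x" "A (A x)"] K(2)[of "A x"]
    by (meson mult_left_mono norm_ge_zero order_trans)
  then have 1: "Re (cinner (A x) (A (A x))) / K\<^sup>2 \<le> (norm (A x))\<^sup>2 / K"
    using K(1) by (simp add: field_simps power2_eq_square)
  have "0 \<le> Re (cinner z (A z))"
    using pos by (simp add: positive_op_def)
  also have "\<dots> = Re (cinner x (A x)) - 2 * (norm (A x))\<^sup>2 / K + Re (cinner (A x) (A (A x))) / K\<^sup>2"
    using K(1) positive_op_selfadjoint[OF A pos, of x "A x"] Re_cinner_self[of "A x"]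
    by (simp add: z_def clinear_diff[OF A] clinear_scaleR[OF A] cinner_diff_left cinner_diff_right
        cinner_scaleR_left cinner_scaleR_right field_simps power2_eq_square)
  finally show ?thesis
    using 1 K(1) mult_left_mono[of "(norm (A x))\<^sup>2 / K" "Re (cinner x (A x))" K] by simp
qed

lemma bounded_clinear_pos_bound:
  assumes "bounded_clinear F"
  obtains K where "K > 0" "\<And>x. norm (F x) \<le> norm x * K"
  using bounded_linear.pos_bounded[OF bounded_clinear_bounded_linear[OF assms]] by blast

lemma positive_op_eq_0:
  assumes "bounded_clinear A" "positive_op A" "Re (cinner x (A x)) = 0"
  shows "A x = 0"
proof -
  obtain K where "K > 0" "\<And>x. norm (A x) \<le> norm x * K"
    using bounded_clinear_pos_bound[OF assms(1)] by blast
  from positive_op_norm_sq_le[OF bounded_clinear_clinear[OF assms(1)] assms(2) this, of x]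
  show ?thesis
    using assms(3) by simp
qed

text \<open>For a self-adjoint contraction \<open>B\<close> the iterates below converge to a solution \<open>Y\<close> of
  \<open>2 Y = B + Y\<^sup>2\<close>, so that \<open>(I - Y)\<^sup>2 = I - B\<close>. Their increments are dominated by those of the
  scalar iteration started with \<open>B = 1\<close>.\<close>

primrec sqrt_iter :: "('a::complex_hilbert \<Rightarrow> 'a) \<Rightarrow> nat \<Rightarrow> 'a \<Rightarrow> 'a" where
  "sqrt_iter B 0 = (\<lambda>x. 0)"
| "sqrt_iter B (Suc n) = (\<lambda>x. (1/2) *\<^sub>R (B x + sqrt_iter B n (sqrt_iter B n x)))"

primrec sqrt_iter_bound :: "nat \<Rightarrow> real" where
  "sqrt_iter_bound 0 = 0"
| "sqrt_iter_bound (Suc n) = (1 + (sqrt_iter_bound n)\<^sup>2) / 2"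

lemma sqrt_iter_bound_range: "0 \<le> sqrt_iter_bound n \<and> sqrt_iter_bound n \<le> 1"
  by (induction n) (auto simp: power_le_one add_nonneg_nonneg)

lemma sqrt_iter_bound_mono: "sqrt_iter_bound n \<le> sqrt_iter_bound (Suc n)"
proof -
  have "0 \<le> (1 - sqrt_iter_bound n)\<^sup>2" by simp
  then show ?thesis
    by (simp add: power2_diff)
qed

lemma bounded_clinear_sqrt_iter: "bounded_clinear B \<Longrightarrow> bounded_clinear (sqrt_iter B n)"
proof (induction n)
  case 0
  then show ?case
    by (auto simp: bounded_clinear_def clinear_def intro: exI[of _ 0])
next
  case (Suc n)
  then have "bounded_clinear (\<lambda>x. B x + sqrt_iter B n (sqrt_iter B n x))"
    by (intro bounded_clinear_add bounded_clinear_compose[of "sqrt_iter B n" "sqrt_iter B n"])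
  then show ?case
    using bounded_clinear_scaleR[of "\<lambda>x. B x + sqrt_iter B n (sqrt_iter B n x)" "1/2"]
    by simp
qed

lemma norm_sqrt_iter:
  assumes B1: "\<And>x. norm (B x) \<le> norm x"
  shows "norm (sqrt_iter B n x) \<le> sqrt_iter_bound n * norm x"
proof (induction n arbitrary: x)
  case (Suc n)
  let ?Y = "sqrt_iter B n" and ?y = "sqrt_iter_bound n"
  have "norm (?Y (?Y x)) \<le> ?y * (?y * norm x)"
    using Suc[of "?Y x"] Suc[of x] sqrt_iter_bound_range[of n] by (meson mult_left_mono order_trans)
  then have "norm (B x + ?Y (?Y x)) \<le> norm x + ?y * (?y * norm x)"
    using norm_triangle_mono[OF B1[of x]] by blast
  then show ?case
    unfolding sqrt_iter.simps sqrt_iter_bound.simps norm_scaleR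
    by (simp add: power2_eq_square field_simps del: scaleR_add_right)
qed simp

text \<open>Writing Y^2 - X^2 = (Y - X) Y + X (Y - X) mirrors the scalar factorisation of y^2 - x^2,
  so the bound passes to the next increment.\<close>

lemma norm_sqrt_iter_diff:
  assumes B: "bounded_clinear B" and B1: "\<And>x. norm (B x) \<le> norm x"
  shows "norm (sqrt_iter B (Suc n) x - sqrt_iter B n x)
    \<le> (sqrt_iter_bound (Suc n) - sqrt_iter_bound n) * norm x"
proof (induction n arbitrary: x)
  case 0
  then show ?case using B1[of x] by simp
next
  case (Suc n)
  let ?X = "sqrt_iter B n" and ?Y = "sqrt_iter B (Suc n)"
  let ?x = "sqrt_iter_bound n" and ?y = "sqrt_iter_bound (Suc n)"
  have d: "0 \<le> ?y - ?x"
    using sqrt_iter_bound_mono[of n] by simp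
  have "norm (?Y (?Y x) - ?X (?Y x)) \<le> (?y - ?x) * norm (?Y x)"
    by (rule Suc)
  also have "\<dots> \<le> (?y - ?x) * (?y * norm x)"
    by (intro mult_left_mono norm_sqrt_iter B1 d)
  finally have 1: "norm (?Y (?Y x) - ?X (?Y x)) \<le> (?y - ?x) * (?y * norm x)" .
  have "norm (?X (?Y x - ?X x)) \<le> ?x * norm (?Y x - ?X x)"
    by (intro norm_sqrt_iter B1)
  also have "\<dots> \<le> ?x * ((?y - ?x) * norm x)"
    using sqrt_iter_bound_range[of n] by (intro mult_left_mono Suc) auto
  finally have 2: "norm (?X (?Y x) - ?X (?X x)) \<le> ?x * ((?y - ?x) * norm x)"
    by (simp only: bcl_diff[OF bounded_clinear_sqrt_iter[OF B]])
  have "sqrt_iter B (Suc (Suc n)) x - ?Y x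
      = (1/2) *\<^sub>R (B x + ?Y (?Y x)) - (1/2) *\<^sub>R (B x + ?X (?X x))"
    by (simp only: sqrt_iter.simps(2))
  also have "\<dots> = (1/2) *\<^sub>R ((?Y (?Y x) - ?X (?Y x)) + (?X (?Y x) - ?X (?X x)))"
    by (simp only: scaleR_diff_right[symmetric] add_diff_add) simp
  finally have "norm (sqrt_iter B (Suc (Suc n)) x - ?Y x)
      \<le> (1/2) * ((?y - ?x) * (?y * norm x) + ?x * ((?y - ?x) * norm x))"
    using norm_triangle_mono[OF 1 2] by (simp only: norm_scaleR) simp
  also have "(1/2) * ((b - a) * (b * c) + a * ((b - a) * c)) = ((1 + b\<^sup>2) / 2 - (1 + a\<^sup>2) / 2) * c"
    for a b c :: real
    by (simp add: power2_eq_square field_simps)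
  finally show ?case
    by (simp only: sqrt_iter_bound.simps(2))
qed

text \<open>The scalar iterates increase and stay below 1, so their increments are summable and
  dominate those of the operator iterates.\<close>

lemma convergent_sqrt_iter:
  assumes B: "bounded_clinear B" and B1: "\<And>x. norm (B x) \<le> norm x"
  shows "convergent (\<lambda>n. sqrt_iter B n x)"
proof -
  let ?d = "\<lambda>n. sqrt_iter_bound (Suc n) - sqrt_iter_bound n"
  have "incseq sqrt_iter_bound"
    using sqrt_iter_bound_mono by (rule incseq_SucI)
  then obtain L where "sqrt_iter_bound \<longlonglongrightarrow> L"
    using incseq_convergent[of sqrt_iter_bound 1] sqrt_iter_bound_range by blast
  then have "summable ?d"
    using telescope_summable by blast
  then have "summable (\<lambda>n. ?d n * norm x)"
    by (rule summable_mult2)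
  then have "summable (\<lambda>n. sqrt_iter B (Suc n) x - sqrt_iter B n x)"
    by (rule summable_comparison_test'[where N = 0]) (rule norm_sqrt_iter_diff[OF B B1])
  then have "convergent (\<lambda>n. sqrt_iter B n x - sqrt_iter B 0 x)"
    unfolding summable_iff_convergent
    using sum_lessThan_telescope[of "\<lambda>n. sqrt_iter B n x"] by (simp only:)
  then show ?thesis
    by simp
qed

text \<open>\<open>R\<close> commutes with \<open>B\<close> only after \<open>E\<close> is applied.
  Since \<open>E\<close> commutes with the iterates, it can be moved next to each factor in
  turn.\<close>

lemma sqrt_iter_intertwine:
  assumes E: "bounded_clinear E" and R: "bounded_clinear R"
    and EB: "\<And>x. E (B x) = B (E x)" and EBR: "\<And>x. E (B (R x)) = E (R (B x))"
  shows "E (sqrt_iter B n x) = sqrt_iter B n (E x)"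
    and "E (sqrt_iter B n (R x)) = E (R (sqrt_iter B n x))"
proof -
  show EY: "E (sqrt_iter B n x) = sqrt_iter B n (E x)" for n x
    by (induction n arbitrary: x) (simp_all add: bcl_zero[OF E] bcl_scaleR[OF E] bcl_add[OF E] EB)
  show "E (sqrt_iter B n (R x)) = E (R (sqrt_iter B n x))"
  proof (induction n arbitrary: x)
    case 0
    then show ?case by (simp add: bcl_zero[OF E] bcl_zero[OF R])
  next
    case (Suc n)
    have "E (sqrt_iter B n (sqrt_iter B n (R x))) = E (R (sqrt_iter B n (sqrt_iter B n x)))"
      by (metis EY Suc)
    then show ?case
      by (simp add: bcl_scaleR[OF E] bcl_add[OF E] bcl_scaleR[OF R] bcl_add[OF R] EBR)
  qed
qed

lemma sqrt_iter_selfadjoint: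
  assumes "\<And>x y. cinner (B x) y = cinner x (B y)"
  shows "cinner (sqrt_iter B n x) y = cinner x (sqrt_iter B n y)"
  by (induction n arbitrary: x y)
    (simp_all add: cinner_scaleR_left cinner_scaleR_right cinner_add_left cinner_add_right assms)

lemma sqrt_of_contraction:
  fixes B :: "'a::complex_hilbert \<Rightarrow> 'a"
  assumes B: "bounded_clinear B" and B1: "\<And>x. norm (B x) \<le> norm x"
    and sa: "\<And>x y. cinner (B x) y = cinner x (B y)"
  shows "\<exists>S. bounded_clinear S \<and> positive_op S \<and> (\<forall>x. S (S x) = x - B x) \<and>
    (\<forall>E R. bounded_clinear E \<and> bounded_clinear R \<and> (\<forall>x. E (B x) = B (E x)) \<and>
      (\<forall>x. E (B (R x)) = E (R (B x))) \<longrightarrow> (\<forall>x. E (S (R x)) = E (R (S x))))"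
proof -
  let ?Y = "sqrt_iter B"
  define L where "L x = lim (\<lambda>n. ?Y n x)" for x
  have L: "(\<lambda>n. ?Y n x) \<longlonglongrightarrow> L x" for x
    unfolding L_def using convergent_LIMSEQ_iff convergent_sqrt_iter[OF B B1] by blast
  note Y = bounded_clinear_sqrt_iter[OF B]
  have Y1: "norm (?Y n x) \<le> norm x" for n x
  proof -
    have "norm (?Y n x) \<le> sqrt_iter_bound n * norm x"
      by (rule norm_sqrt_iter[OF B1])
    also have "\<dots> \<le> 1 * norm x"
      using sqrt_iter_bound_range[of n] by (intro mult_right_mono) auto
    finally show ?thesis by simp
  qed
  have L1: "norm (L x) \<le> norm x" for x
    by (rule LIMSEQ_le_const2[OF tendsto_norm[OF L]]) (use Y1 in blast)
  have "L (x + y) = L x + L y" for x y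
    using tendsto_add[OF L[of x] L[of y]] L[of "x + y"]
    by (simp add: bcl_add[OF Y] LIMSEQ_unique)
  moreover have "L (scaleC a x) = scaleC a (L x)" for a x
    using bounded_linear.tendsto[OF bounded_linear_scaleC L[of x], of a] L[of "scaleC a x"]
    by (simp add: bcl_scaleC[OF Y] LIMSEQ_unique)
  ultimately have bL: "bounded_clinear L"
    unfolding bounded_clinear_def clinear_def using L1 by (metis mult.right_neutral)
  have LL: "L (L x) = 2 *\<^sub>R L x - B x" for x
  proof -
    \<comment> \<open>Pointwise convergence suffices for the square because all iterates are
      contractions.\<close>
    have "(\<lambda>n. ?Y n (?Y n x - L x)) \<longlonglongrightarrow> 0"
      by (rule Lim_null_comparison[OF _ tendsto_norm_zero[OF LIM_zero[OF L[of x]]]]) (use Y1 in auto)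
    from tendsto_add[OF this L[of "L x"]] have "(\<lambda>n. ?Y n (?Y n x)) \<longlonglongrightarrow> L (L x)"
      by (simp add: bcl_diff[OF Y])
    then have "(\<lambda>n. ?Y (Suc n) x) \<longlonglongrightarrow> (1/2) *\<^sub>R (B x + L (L x))"
      by (auto intro!: tendsto_intros)
    with LIMSEQ_Suc[OF L[of x]] have "L x = (1/2) *\<^sub>R (B x + L (L x))"
      by (rule LIMSEQ_unique)
    from arg_cong[OF this, of "(*\<^sub>R) 2"] show ?thesis
      by (simp add: scaleR_add_right[symmetric] del: scaleR_add_right)
  qed
  define S where "S x = x - L x" for x
  have bS: "bounded_clinear S"
    unfolding S_def by (intro bounded_clinear_diff bounded_clinear_ident bL)
  have "Im (cinner x (L x)) = 0" for x
  proof -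
    have "Im (cinner x (?Y n x)) = 0" for n
      using arg_cong[OF cinner_commute[of x "?Y n x"], of Im] sqrt_iter_selfadjoint[OF sa, of n x x]
      by simp
    moreover have "(\<lambda>n. Im (cinner x (?Y n x))) \<longlonglongrightarrow> Im (cinner x (L x))"
      by (intro tendsto_intros bounded_linear.tendsto[OF bounded_linear_cinner_right] L)
    ultimately show ?thesis
      by (simp add: LIMSEQ_const_iff)
  qed
  moreover have "Re (cinner x (L x)) \<le> (norm x)\<^sup>2" for x
    using Re_cinner_le[of x "L x"] mult_left_mono[OF L1[of x] norm_ge_zero[of x]]
    by (simp add: power2_eq_square)
  ultimately have pS: "positive_op S"
    by (simp add: positive_op_def S_def cinner_diff_right cinner_self power2_eq_square)
  have SS: "S (S x) = x - B x" for x
    by (simp add: S_def bcl_diff[OF bL] LL scaleR_2)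
  have "E (S (R x)) = E (R (S x))"
    if E: "bounded_clinear E" and R: "bounded_clinear R" and EB: "\<forall>x. E (B x) = B (E x)"
      and EBR: "\<forall>x. E (B (R x)) = E (R (B x))" for E R x
  proof -
    note tE = bounded_linear.tendsto[OF bounded_clinear_bounded_linear[OF E]]
    note tR = bounded_linear.tendsto[OF bounded_clinear_bounded_linear[OF R]]
    have "E (?Y n (R x)) = E (R (?Y n x))" for n
      using sqrt_iter_intertwine(2)[OF E R] EB EBR by blast
    then have "E (L (R x)) = E (R (L x))"
      using tE[OF L[of "R x"]] tE[OF tR[OF L[of x]]] by (simp add: LIMSEQ_unique)
    then show ?thesis
      by (simp add: S_def bcl_diff[OF E] bcl_diff[OF R])
  qed
  then show ?thesis
    using bS pS SS by blast
qed

text \<open>The operator B = I - A/K is a self-adjoint contraction by A^2 \<le> K A, and the root of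
  I - B is rescaled by \<open>sqrt K\<close>. The intertwining clause is kept because regularity
  enters through it.\<close>

lemma positive_sqrt_exists:
  fixes A :: "'a::complex_hilbert \<Rightarrow> 'a"
  assumes A: "bounded_clinear A" and pos: "positive_op A"
  shows "\<exists>S. bounded_clinear S \<and> positive_op S \<and> (\<forall>x. S (S x) = A x) \<and>
    (\<forall>E R. bounded_clinear E \<and> bounded_clinear R \<and> (\<forall>x. E (A x) = A (E x)) \<and>
      (\<forall>x. E (A (R x)) = E (R (A x))) \<longrightarrow> (\<forall>x. E (S (R x)) = E (R (S x))))"
proof -
  obtain K where K: "K > 0" "\<And>x. norm (A x) \<le> norm x * K"
    using bounded_clinear_pos_bound[OF A] by blast
  define B where "B x = x - (1/K) *\<^sub>R A x" for x
  have B: "bounded_clinear B"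
    unfolding B_def by (intro bounded_clinear_diff bounded_clinear_ident bounded_clinear_scaleR A)
  have B1: "norm (B x) \<le> norm x" for x
  proof -
    have "(norm (B x))\<^sup>2 = (norm x)\<^sup>2 - 2 * Re (cinner x (A x)) / K + (norm (A x))\<^sup>2 / K\<^sup>2"
      using norm_add_sq[of x "- ((1/K) *\<^sub>R A x)"] K(1)
      by (simp add: B_def cinner_minus_right cinner_scaleR_right power_divide)
    also have "(norm (A x))\<^sup>2 / K\<^sup>2 \<le> Re (cinner x (A x)) / K"
      using positive_op_norm_sq_le[OF bounded_clinear_clinear[OF A] pos K, of x] K(1)
      by (simp add: field_simps power2_eq_square)
    also have "(norm x)\<^sup>2 - 2 * Re (cinner x (A x)) / K + Re (cinner x (A x)) / K \<le> (norm x)\<^sup>2"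
      using pos K(1) by (simp add: positive_op_def field_simps)
    finally show ?thesis
      by (simp add: power2_le_iff_abs_le)
  qed
  have sa: "cinner (B x) y = cinner x (B y)" for x y
    using positive_op_selfadjoint[OF bounded_clinear_clinear[OF A] pos]
    by (simp add: B_def cinner_diff_left cinner_diff_right cinner_scaleR_left cinner_scaleR_right)
  obtain S where S: "bounded_clinear S" "positive_op S" "\<forall>x. S (S x) = x - B x"
    and comm: "\<forall>E R. bounded_clinear E \<and> bounded_clinear R \<and> (\<forall>x. E (B x) = B (E x)) \<and>
      (\<forall>x. E (B (R x)) = E (R (B x))) \<longrightarrow> (\<forall>x. E (S (R x)) = E (R (S x)))"
    using sqrt_of_contraction[OF B B1 sa] by blast
  define S' where "S' x = sqrt K *\<^sub>R S x" for x
  have "bounded_clinear S'"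
    unfolding S'_def by (intro bounded_clinear_scaleR S)
  moreover have "positive_op S'"
    using S(2) K(1) by (simp add: positive_op_def S'_def cinner_scaleR_right)
  moreover have "S' (S' x) = A x" for x
    using S(3) K(1) by (simp add: S'_def bcl_scaleR[OF S(1)] B_def)
  moreover have "E (S' (R x)) = E (R (S' x))"
    if E: "bounded_clinear E" and R: "bounded_clinear R" and EA: "\<forall>x. E (A x) = A (E x)"
      and EAR: "\<forall>x. E (A (R x)) = E (R (A x))" for E R x
  proof -
    have "E (S (R x)) = E (R (S x))"
      using comm E R EA EAR by (simp add: B_def bcl_diff[OF E] bcl_diff[OF R] bcl_scaleR[OF E] bcl_scaleR[OF R])
    then show ?thesis
      by (simp add: S'_def bcl_scaleR[OF E] bcl_scaleR[OF R])
  qed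
  ultimately show ?thesis by blast
qed

text \<open>For y = (S - S') x, commutation gives (S + S') y = (S^2 - S'^2) x = 0. Hence both
  positive forms vanish at \<open>y\<close>, and the squared norm of \<open>y\<close> is the inner
  product of \<open>x\<close> with (S - S') y = 0.\<close>

lemma positive_sqrt_unique:
  assumes S: "bounded_clinear S" "positive_op S" and S': "bounded_clinear S'" "positive_op S'"
    and eq: "\<And>x. S (S x) = S' (S' x)" and comm: "\<And>x. S' (S x) = S (S' x)"
  shows "S = S'"
proof
  fix x
  define y where "y = S x - S' x"
  have "S y + S' y = 0"
    by (simp add: y_def bcl_diff[OF S(1)] bcl_diff[OF S'(1)] eq comm)
  then have "Re (cinner y (S y)) + Re (cinner y (S' y)) = 0"
    by (metis cinner_add_right cinner_zero_right plus_complex.simps(1) zero_complex.simps(1))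
  moreover have "Re (cinner y (S y)) \<ge> 0" "Re (cinner y (S' y)) \<ge> 0"
    using S S' by (auto simp: positive_op_def)
  ultimately have "S y = 0" "S' y = 0"
    using positive_op_eq_0 S S' by (metis add_nonneg_eq_0_iff)+
  have "cinner y y = cinner x (S y) - cinner x (S' y)"
    using positive_op_selfadjoint[OF bounded_clinear_clinear] S S'
    by (metis cinner_diff_left y_def)
  then have "cinner y y = 0"
    using \<open>S y = 0\<close> \<open>S' y = 0\<close> by simp
  then show "S x = S' x"
    by (simp add: cinner_self y_def)
qed

lemma op_sqrt_works:
  assumes A: "bounded_clinear A" and pos: "positive_op A"
  shows bounded_clinear_op_sqrt: "bounded_clinear (op_sqrt A)"
    and positive_op_sqrt: "positive_op (op_sqrt A)"
    and op_sqrt_square: "op_sqrt A (op_sqrt A x) = A x"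
    and op_sqrt_intertwine: "\<lbrakk>bounded_clinear E; bounded_clinear R; \<And>x. E (A x) = A (E x);
      \<And>x. E (A (R x)) = E (R (A x))\<rbrakk> \<Longrightarrow> E (op_sqrt A (R x)) = E (R (op_sqrt A x))"
proof -
  obtain S where S: "bounded_clinear S" "positive_op S" "\<forall>x. S (S x) = A x"
    and comm: "\<And>E R x. bounded_clinear E \<Longrightarrow> bounded_clinear R \<Longrightarrow> \<forall>x. E (A x) = A (E x) \<Longrightarrow>
      \<forall>x. E (A (R x)) = E (R (A x)) \<Longrightarrow> E (S (R x)) = E (R (S x))"
    using positive_sqrt_exists[OF A pos] by blast
  have "op_sqrt A = S"
    unfolding op_sqrt_def
  proof (rule the_equality)
    fix S' assume S': "bounded_clinear S' \<and> positive_op S' \<and> (\<forall>x. S' (S' x) = A x)"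
    \<comment> \<open>A competing root commutes with its own square \<open>A\<close>; the
      intertwining clause with \<open>E\<close> the identity and \<open>R = S'\<close> makes it
      commute with \<open>S\<close>.\<close>
    have "S' (S x) = S (S' x)" for x
      using comm[OF bounded_clinear_ident, of S' x] S' by metis
    then show "S' = S"
      using positive_sqrt_unique[of S S'] S S' by simp
  qed (use S in blast)
  then show "bounded_clinear (op_sqrt A)" "positive_op (op_sqrt A)" "op_sqrt A (op_sqrt A x) = A x"
    "\<lbrakk>bounded_clinear E; bounded_clinear R; \<And>x. E (A x) = A (E x);
      \<And>x. E (A (R x)) = E (R (A x))\<rbrakk> \<Longrightarrow> E (op_sqrt A (R x)) = E (R (op_sqrt A x))"
    using S comm by auto
qed

section \<open>Regularity without square roots\<close>

lemma norm_op_sqrt_sq: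
  assumes "bounded_clinear A" "positive_op A"
  shows "(norm (op_sqrt A x))\<^sup>2 = Re (cinner x (A x))"
  using positive_op_selfadjoint[OF bounded_clinear_clinear[OF bounded_clinear_op_sqrt[OF assms]]
      positive_op_sqrt[OF assms], of x "op_sqrt A x"]
  by (simp add: op_sqrt_square[OF assms] flip: Re_cinner_self)

text \<open>Write S for the root. Forward, A^2 R = S (A R S) = A R A after using regularity twice.
  Backward, intertwining with \<open>E = A\<close> gives A S R = A R S, and \<open>A\<close> and S
  have the same kernel.\<close>

lemma A_regular_iff:
  assumes A: "bounded_clinear A" "positive_op A" and R: "bounded_clinear R"
  shows "A_regular A R \<longleftrightarrow> (\<forall>x. A (A (R x)) = A (R (A x)))"
proof
  let ?S = "op_sqrt A"
  note SS = op_sqrt_square[OF A]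
  {
    assume reg: "A_regular A R"
    show "\<forall>x. A (A (R x)) = A (R (A x))"
      using reg SS unfolding A_regular_def by metis
  next
    assume *: "\<forall>x. A (A (R x)) = A (R (A x))"
    show "A_regular A R"
      unfolding A_regular_def
    proof
      fix x
      define z where "z = ?S (R x) - R (?S x)"
      have "A (?S (R x)) = A (R (?S x))"
        by (rule op_sqrt_intertwine[OF A A(1) R]) (use * in auto)
      then have "A z = 0"
        by (simp add: z_def bcl_diff[OF A(1)])
      then have "?S z = 0"
        using norm_op_sqrt_sq[OF A, of z] by simp
      then show "A (R x) = ?S (R (?S x))"
        by (simp add: z_def bcl_diff[OF bounded_clinear_op_sqrt[OF A]] SS)
    qed
  }
qed

lemma op_le_iff_selfadjoint:
  assumes "\<And>x. Im (cinner x (A x)) = 0" "\<And>x. Im (cinner x (B x)) = 0"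
  shows "op_le A B \<longleftrightarrow> (\<forall>x. Re (cinner x (A x)) \<le> Re (cinner x (B x)))"
  using assms by (simp add: op_le_def positive_op_def cinner_diff_right)

lemma A_contraction_iff:
  assumes A: "positive_op A" and R: "bounded_clinear R"
  shows "A_contraction A R \<longleftrightarrow> (\<forall>x. Re (cinner (R x) (A (R x))) \<le> Re (cinner x (A x)))"
  using op_le_iff_selfadjoint[of "\<lambda>x. adj R (A (R x))" A] A
  by (simp add: A_contraction_def positive_op_def cinner_adj[OF R])

text \<open>Regularity turns the squared norm of S R x into the inner product of S R x and R S x,
  where S is the root; Cauchy-Schwarz then allows cancellation. This supplies the contraction half
  of condition (iv).\<close>

lemma A_regular_imp_A_contraction:
  assumes A: "bounded_clinear A" "positive_op A" and R: "bounded_clinear R"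
    and R1: "\<And>x. norm (R x) \<le> norm x" and reg: "A_regular A R"
  shows "A_contraction A R"
  unfolding A_contraction_iff[OF A(2) R]
proof
  fix x
  let ?S = "op_sqrt A"
  have "(norm (?S (R x)))\<^sup>2 = Re (cinner (R x) (?S (R (?S x))))"
    using reg by (simp add: norm_op_sqrt_sq[OF A] A_regular_def)
  also have "\<dots> = Re (cinner (?S (R x)) (R (?S x)))"
    using positive_op_selfadjoint[OF bounded_clinear_clinear[OF bounded_clinear_op_sqrt[OF A]]
      positive_op_sqrt[OF A]] by simp
  also have "\<dots> \<le> norm (?S (R x)) * norm (?S x)"
    using Re_cinner_le R1 by (meson mult_left_mono norm_ge_zero order_trans)
  finally have "norm (?S (R x)) \<le> norm (?S x)"
    by (cases "?S (R x) = 0") (auto simp: power2_eq_square)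
  then have "(norm (?S (R x)))\<^sup>2 \<le> (norm (?S x))\<^sup>2"
    by (simp add: power_mono)
  then show "Re (cinner (R x) (A (R x))) \<le> Re (cinner x (A x))"
    by (simp add: norm_op_sqrt_sq[OF A])
qed

section \<open>Concave operators\<close>

text \<open>A single decrease would recur at every later step by concavity and drive the sequence
  below zero.\<close>

lemma concave_seq_mono:
  fixes a :: "nat \<Rightarrow> real"
  assumes conc: "\<And>n. a (Suc (Suc n)) - a (Suc n) \<le> a (Suc n) - a n" and nonneg: "\<And>n. 0 \<le> a n"
  shows "a n \<le> a (Suc n)"
proof (rule ccontr)
  define d where "d = a n - a (Suc n)"
  assume "\<not> a n \<le> a (Suc n)"
  then have d: "d > 0" by (simp add: d_def)
  have step: "a (Suc (n + k)) - a (n + k) \<le> - d" for k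
  proof (induction k)
    case (Suc k)
    then show ?case using conc[of "n + k"] by simp
  qed (simp add: d_def)
  have "a (n + k) \<le> a n - real k * d" for k
  proof (induction k)
    case (Suc k)
    then show ?case using step[of k] by (simp add: algebra_simps)
  qed simp
  moreover obtain k :: nat where "a n < real k * d"
    using ex_less_of_nat_mult[OF d] by blast
  ultimately show False
    using nonneg[of "n + k"] by (smt (verit))
qed

text \<open>Shifting a window of length \<open>m\<close> by one trades its first increment for a
  later one, which is no larger.\<close>

lemma concave_seq_increment_antimono:
  fixes a :: "nat \<Rightarrow> real"
  assumes conc: "\<And>n. a (Suc (Suc n)) - a (Suc n) \<le> a (Suc n) - a n"
  shows "a (m + n) - a n \<le> a m - a 0"
proof -
  have "decseq (\<lambda>n. a (Suc n) - a n)"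
    by (rule decseq_SucI) (rule conc)
  then have dec: "a (Suc (m + n)) - a (m + n) \<le> a (Suc n) - a n" for m n
    by (simp add: decseq_def)
  show ?thesis
  proof (induction n)
    case (Suc n)
    then show ?case using dec[of m n] by simp
  qed simp
qed

section \<open>The quadratic form of the defect operator\<close>

lemma bounded_clinear_Delta: "bounded_clinear F \<Longrightarrow> bounded_clinear (Delta F)"
  unfolding Delta_def
  by (intro bounded_clinear_diff bounded_clinear_ident bounded_clinear_compose[of "adj F" F]
      bounded_clinear_adj)

lemma cinner_Delta:
  "bounded_clinear F \<Longrightarrow> cinner x (Delta F x) = complex_of_real ((norm (F x))\<^sup>2 - (norm x)\<^sup>2)"
  by (simp add: Delta_def cinner_diff_right cinner_adj cinner_self)

lemma positive_op_Delta:
  "bounded_clinear F \<Longrightarrow> (\<And>x. norm x \<le> norm (F x)) \<Longrightarrow> positive_op (Delta F)"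
  by (simp add: positive_op_def cinner_Delta power_mono)

lemma Delta_eq_0_iff:
  assumes F: "bounded_clinear F" and "\<And>x. norm x \<le> norm (F x)"
  shows "Delta F x = 0 \<longleftrightarrow> norm (F x) = norm x"
proof
  assume "Delta F x = 0"
  then show "norm (F x) = norm x"
    using cinner_Delta[OF F, of x] by (simp add: complex_eq_iff power2_eq_iff_nonneg)
next
  assume "norm (F x) = norm x"
  then show "Delta F x = 0"
    using positive_op_eq_0[OF bounded_clinear_Delta positive_op_Delta, OF F F assms(2)]
    by (simp add: cinner_Delta[OF F])
qed

lemma concave_op_norm_le:
  assumes T: "bounded_clinear T" and "concave_op T"
  shows "(norm (T (T x)))\<^sup>2 - (norm (T x))\<^sup>2 \<le> (norm (T x))\<^sup>2 - (norm x)\<^sup>2"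
proof -
  have "0 \<le> Re (cinner x (0 - (adj T (adj T (T (T x))) - 2 *\<^sub>R adj T (T x) + x)))"
    using assms(2) by (simp add: concave_op_def op_le_def positive_op_def)
  then show ?thesis
    by (simp add: cinner_minus_right cinner_add_right cinner_diff_right cinner_scaleR_right
        cinner_adj[OF T] cinner_self)
qed

lemma norm_le_norm_funpow:
  fixes F :: "'a::real_normed_vector \<Rightarrow> 'a"
  assumes "\<And>x. norm x \<le> norm (F x)"
  shows "norm x \<le> norm ((F ^^ n) x)"
proof (induction n)
  case (Suc n)
  then show ?case using assms[of "(F ^^ n) x"] by simp
qed simp

locale concave =
  fixes T :: "'a::complex_hilbert \<Rightarrow> 'a"
  assumes T: "bounded_clinear T" and concave: "concave_op T"
begin

lemma norm_funpow_increments: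
  "(norm ((T ^^ Suc (Suc n)) x))\<^sup>2 - (norm ((T ^^ Suc n) x))\<^sup>2
    \<le> (norm ((T ^^ Suc n) x))\<^sup>2 - (norm ((T ^^ n) x))\<^sup>2"
  using concave_op_norm_le[OF T concave, of "(T ^^ n) x"] by simp

lemma expansive: "norm x \<le> norm (T x)"
  using concave_seq_mono[of "\<lambda>n. (norm ((T ^^ n) x))\<^sup>2" 0] norm_funpow_increments
  by (simp add: power2_le_iff_abs_le)

lemmas expansive_funpow = norm_le_norm_funpow[OF expansive]

text \<open>For the sequence of squared norms along the orbit of \<open>x\<close>, the claim
  compares the growth over \<open>m\<close> steps from time \<open>n\<close> with that from time
  0.\<close>

lemma A_contraction_funpow: "A_contraction (Delta (T ^^ m)) (T ^^ n)"
proof -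
  note bT = bounded_clinear_funpow[OF T]
  have "(norm ((T ^^ (m + n)) x))\<^sup>2 - (norm ((T ^^ n) x))\<^sup>2 \<le> (norm ((T ^^ m) x))\<^sup>2 - (norm x)\<^sup>2" for x
    using concave_seq_increment_antimono[of "\<lambda>n. (norm ((T ^^ n) x))\<^sup>2" m n] norm_funpow_increments
    by simp
  then show ?thesis
    by (simp add: A_contraction_iff[OF positive_op_Delta[OF bT expansive_funpow] bT]
        cinner_Delta[OF bT] funpow_add)
qed

lemma ker_Delta_funpow:
  assumes "n \<ge> 1"
  shows "ker_op (Delta (T ^^ n)) = ker_op (Delta T)"
proof -
  have "norm ((T ^^ n) x) = norm x \<longleftrightarrow> norm (T x) = norm x" for x
  proof
    obtain k where k: "n = Suc k"
      using assms by (metis Suc_le_D One_nat_def)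
    assume "norm ((T ^^ n) x) = norm x"
    \<comment> \<open>The norm of \<open>T x\<close> is squeezed between those of \<open>x\<close>
      and \<open>(T ^^ n) x\<close>.\<close>
    moreover have "norm (T x) \<le> norm ((T ^^ n) x)"
      using expansive_funpow[of "T x" k] by (simp add: k funpow_swap1)
    ultimately show "norm (T x) = norm x"
      using expansive[of x] by simp
  next
    assume eq: "norm (T x) = norm x"
    \<comment> \<open>A vanishing first increment bounds all later increments above by zero.\<close>
    have "(norm ((T ^^ n) x))\<^sup>2 \<le> (norm x)\<^sup>2"
    proof (induction n)
      case (Suc n)
      have "(norm ((T ^^ (1 + n)) x))\<^sup>2 - (norm ((T ^^ n) x))\<^sup>2 \<le> (norm ((T ^^ 1) x))\<^sup>2 - (norm ((T ^^ 0) x))\<^sup>2"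
        using concave_seq_increment_antimono[of "\<lambda>n. (norm ((T ^^ n) x))\<^sup>2" 1 n] norm_funpow_increments
        by blast
      with Suc eq show ?case by simp
    qed simp
    then show "norm ((T ^^ n) x) = norm x"
      using expansive_funpow[of x n] by (simp add: power2_le_iff_abs_le)
  qed
  then show ?thesis
    by (simp add: ker_op_def Delta_eq_0_iff[OF T expansive]
        Delta_eq_0_iff[OF bounded_clinear_funpow[OF T] expansive_funpow])
qed

end

section \<open>Range and kernel of a positive operator\<close>

lemma closed_csubspace_ker:
  assumes "bounded_clinear A"
  shows "closed_csubspace (ker_op A)"
  unfolding closed_csubspace_def ker_op_def
proof (intro conjI)
  have "continuous_on UNIV A"
    using bounded_clinear_bounded_linear[OF assms] linear_continuous_on by blast
  then show "closed {x. A x = 0}"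
    by (intro closed_Collect_eq) auto
qed (auto simp: bcl_zero[OF assms] bcl_add[OF assms] bcl_scaleC[OF assms])

lemma closed_csubspace_closure_range:
  assumes A: "bounded_clinear A"
  shows "closed_csubspace (closure (range A))"
  unfolding closed_csubspace_def
proof (intro conjI)
  show "0 \<in> closure (range A)"
    using closure_subset[of "range A"] bcl_zero[OF A] by (metis rangeI subsetD)
  show "\<forall>x\<in>closure (range A). \<forall>y\<in>closure (range A). x + y \<in> closure (range A)"
  proof (intro ballI)
    fix x y assume "x \<in> closure (range A)" "y \<in> closure (range A)"
    then obtain X Y where "\<And>n. X n \<in> range A" "X \<longlonglongrightarrow> x" "\<And>n. Y n \<in> range A" "Y \<longlonglongrightarrow> y"
      unfolding closure_sequential by blast
    moreover from this have "X n + Y n \<in> range A" for n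
      by (metis (no_types, lifting) bcl_add[OF A] rangeE rangeI)
    ultimately show "x + y \<in> closure (range A)"
      unfolding closure_sequential
      by (intro exI[of _ "\<lambda>n. X n + Y n"]) (simp add: tendsto_add)
  qed
  have "scaleC a ` range A \<subseteq> range A" for a
    by (auto simp: bcl_scaleC[OF A, symmetric])
  then have "scaleC a ` closure (range A) \<subseteq> closure (range A)" for a
    using closure_bounded_linear_image_subset[OF bounded_linear_scaleC, of a "range A"]
    by (meson closure_mono order_trans)
  then show "\<forall>a. \<forall>x\<in>closure (range A). scaleC a x \<in> closure (range A)"
    by blast
qed simp

locale selfadjoint =
  fixes A :: "'a::complex_hilbert \<Rightarrow> 'a"
  assumes A: "bounded_clinear A" and A_sa: "\<And>x y. cinner (A x) y = cinner x (A y)"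
begin

abbreviation "M \<equiv> closure (range A)"
abbreviation "P \<equiv> proj M"

lemmas M = closed_csubspace_closure_range[OF A]
lemmas bP = bounded_clinear_proj[OF M]

lemma P_in: "P x \<in> M"
  by (rule proj_in[OF M])

lemma P_ident: "x \<in> M \<Longrightarrow> P x = x"
  by (rule proj_ident[OF M])

lemma P_P [simp]: "P (P x) = P x"
  by (simp add: P_ident P_in)

lemma A_in: "A x \<in> M"
  by (simp add: closure_subset[THEN subsetD])

lemma P_A [simp]: "P (A x) = A x"
  by (simp add: P_ident A_in)

lemma A_P [simp]: "A (P x) = A x"
proof (rule cinner_ext)
  show "cinner z (A (P x)) = cinner z (A x)" for z
    by (simp add: A_sa[symmetric] cinner_proj[OF M A_in])
qed

text \<open>Self-adjointness gives orthogonality to the range, and it extends to the closure since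
  the orthogonal complement of \<open>x\<close> is closed.\<close>

lemma cinner_ker_range:
  assumes "A x = 0" "y \<in> M"
  shows "cinner x y = 0"
proof -
  have "continuous_on UNIV (cinner x)"
    using bounded_linear_cinner_right linear_continuous_on by blast
  then have "closed {z. cinner x z = 0}"
    by (intro closed_Collect_eq) auto
  moreover have "range A \<subseteq> {z. cinner x z = 0}"
    using assms(1) by (auto simp: A_sa[symmetric])
  ultimately have "M \<subseteq> {z. cinner x z = 0}"
    by (rule closure_minimal[rotated])
  then show ?thesis
    using assms(2) by blast
qed

text \<open>A vector in both \<open>M\<close> and the kernel is orthogonal to itself. Membership in
  \<open>M\<close> is phrased as \<open>P x = x\<close> so that rewriting can establish it.\<close>

lemma A_inj_on_M: "P x = x \<Longrightarrow> A x = 0 \<Longrightarrow> x = 0"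
  using cinner_ker_range[of x x] P_in[of x] by (simp add: cinner_self)

lemma A_A_eq_0: "A (A x) = 0 \<Longrightarrow> A x = 0"
  using A_inj_on_M[of "A x"] by simp

lemma P_eq_0_iff: "P x = 0 \<longleftrightarrow> A x = 0"
  using A_P[of x] A_inj_on_M[of "P x"] bcl_zero[OF A] by fastforce

lemma proj_ker: "proj (ker_op A) x = x - P x"
proof (rule proj_eqI[OF closed_csubspace_ker[OF A]])
  show "x - P x \<in> ker_op A"
    by (simp add: ker_op_def bcl_diff[OF A])
  show "cinner z (x - (x - P x)) = 0" if "z \<in> ker_op A" for z
    using that cinner_ker_range[of z "P x"] P_in by (simp add: ker_op_def)
qed

lemma adj_on_compression:
  assumes F: "bounded_clinear F"
  shows "adj_on M (\<lambda>x. P (F x)) y = P (adj F (P y))"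
proof (rule adj_on_eqI[OF M P_in])
  show "cinner (P (F x)) y = cinner x (P (adj F (P y)))" if "x \<in> M" for x
    using that by (simp add: cinner_proj_swap[OF M] cinner_proj[OF M that] cinner_adj[OF F])
qed

lemma adj_on_compression_ker:
  assumes F: "bounded_clinear F"
  shows "adj_on M (\<lambda>x. proj (ker_op A) (F x)) y = P (adj F (y - P y))"
proof (rule adj_on_eqI[OF M P_in])
  show "cinner (proj (ker_op A) (F x)) y = cinner x (P (adj F (y - P y)))" if "x \<in> M" for x
    using that by (simp add: cinner_proj[OF M that] cinner_adj[OF F] proj_ker cinner_diff_left
        cinner_diff_right cinner_proj_swap[OF M])
qed

end

section \<open>Expansive operators that are regular for their defect\<close>

locale expansive_regular =
  fixes T :: "'a::complex_hilbert \<Rightarrow> 'a"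
  assumes T: "bounded_clinear T" and expansive: "\<And>x. norm x \<le> norm (T x)"
    and regular: "A_regular (Delta T) T"
begin

lemmas positive_Delta = positive_op_Delta[OF T expansive]

sublocale selfadjoint "Delta T"
  by unfold_locales (rule bounded_clinear_Delta[OF T],
      rule positive_op_selfadjoint[OF bounded_clinear_clinear[OF bounded_clinear_Delta[OF T]] positive_Delta])

abbreviation "A \<equiv> Delta T"
abbreviation "T_adj \<equiv> adj T"

text \<open>\<open>W\<close> extends the compression of \<open>T\<close> to \<open>M\<close> by \<open>0\<close> on the kernel of \<open>A\<close>, and \<open>V\<close> is the adjoint
  of \<open>W\<close>.\<close>

definition W :: "'a \<Rightarrow> 'a" where "W x = P (T x)"
definition V :: "'a \<Rightarrow> 'a" where "V x = T_adj (P x)"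

lemmas bT_adj = bounded_clinear_adj[OF T]

lemma bW: "bounded_clinear W"
  unfolding W_def[abs_def] by (rule bounded_clinear_compose[OF bP T])

lemma bV: "bounded_clinear V"
  unfolding V_def[abs_def] by (rule bounded_clinear_compose[OF bT_adj bP])

lemma T_adj_T: "T_adj (T x) = x + A x"
  by (simp add: Delta_def)

lemma A_A_T: "A (A (T x)) = A (T (A x))"
  using regular A_regular_iff[OF A positive_Delta T] by blast

lemma P_W [simp]: "P (W x) = W x"
  by (simp add: W_def)

lemma W_in: "W x \<in> M"
  by (simp add: W_def P_in)

lemma A_T: "A (T x) = A (W x)"
  by (simp add: W_def)

text \<open>By A^2 T = A T A, \<open>T\<close> maps the kernel of \<open>A\<close> into itself, so
  the component of \<open>x\<close> outside \<open>M\<close> contributes nothing.\<close>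

lemma W_P [simp]: "W (P x) = W x"
proof -
  have "A (x - P x) = 0"
    by (simp add: bcl_diff[OF A])
  then have "A (A (T (x - P x))) = 0"
    by (simp add: A_A_T bcl_zero[OF A] bcl_zero[OF T])
  then have "P (T (x - P x)) = 0"
    using A_A_eq_0 P_eq_0_iff by blast
  then show ?thesis
    by (simp add: W_def bcl_diff[OF T] bcl_diff[OF bP])
qed

lemma W_T: "W (T x) = W (W x)"
  by (metis W_P W_def)

text \<open>Both sides lie in \<open>M\<close>, where \<open>A\<close> is injective, so one factor
  \<open>A\<close> can be cancelled from A^2 T = A T A.\<close>

lemma W_A: "W (A x) = A (W x)"
proof -
  define z where "z = W (A x) - A (W x)"
  have "P z = z"
    by (simp add: z_def bcl_diff[OF bP])
  moreover have "A z = 0"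
    by (simp add: z_def bcl_diff[OF A] A_T[symmetric] A_A_T)
  ultimately show ?thesis
    using A_inj_on_M[of z] by (simp add: z_def)
qed

lemma cinner_V: "cinner x (V y) = cinner (W x) y"
  by (simp add: V_def W_def cinner_adj[OF T] cinner_proj_swap[OF M])

lemma P_V [simp]: "P (V x) = V x"
proof (rule cinner_ext)
  show "cinner z (P (V x)) = cinner z (V x)" for z
    by (simp add: cinner_proj_swap[OF M, symmetric] cinner_V)
qed

lemma V_A: "V (A x) = A (V x)"
proof (rule cinner_ext)
  show "cinner z (V (A x)) = cinner z (A (V x))" for z
    by (simp add: cinner_V A_sa[symmetric] W_A)
qed

lemma V_T: "V (T x) = V (W x)"
  by (simp add: V_def W_def)

lemma T_adj_A: "T_adj (A x) = A (V x)"
  using V_A[of x] by (simp add: V_def)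

subsection \<open>The inverse of \<open>T\<^sup>*T\<close>\<close>

definition G :: "'a \<Rightarrow> 'a" where "G = inv (\<lambda>x. T_adj (T x))"

lemma norm_T_adj_T: "norm x \<le> norm (T_adj (T x))"
proof -
  have "norm x * norm x \<le> norm (T x) * norm (T x)"
    using expansive[of x] by (simp add: mult_mono)
  also have "\<dots> = Re (cinner x (T_adj (T x)))"
    by (simp add: cinner_adj[OF T] cinner_self power2_eq_square)
  also have "\<dots> \<le> norm x * norm (T_adj (T x))"
    by (rule Re_cinner_le)
  finally show ?thesis
    by (cases "x = 0") auto
qed

text \<open>Being bounded below gives injectivity and a complete, hence closed, range. A vector
  \<open>z\<close> orthogonal to the range satisfies \<open>T z = 0\<close>, so it vanishes.\<close>

lemma bij_T_adj_T: "bij (\<lambda>x. T_adj (T x))"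
proof -
  let ?B = "\<lambda>x. T_adj (T x)"
  have B: "bounded_clinear ?B"
    by (rule bounded_clinear_compose[OF bT_adj T])
  have "inj ?B"
  proof (rule injI)
    fix x y assume "?B x = ?B y"
    then have "?B (x - y) = 0"
      by (simp add: bcl_diff[OF B])
    then show "x = y"
      using norm_T_adj_T[of "x - y"] by simp
  qed
  moreover have "surj ?B"
  proof -
    have "complete (range ?B)"
      by (rule complete_isometric_image[of 1])
        (use norm_T_adj_T in \<open>auto simp: bounded_clinear_bounded_linear[OF B] complete_UNIV\<close>)
    then have "closure (range ?B) = range ?B"
      by (simp add: complete_imp_closed)
    then have R: "closed_csubspace (range ?B)"
      using closed_csubspace_closure_range[OF B] by simp
    have "y \<in> range ?B" for y
    proof -
      define z where "z = y - proj (range ?B) y"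
      have "cinner (?B x) z = 0" for x
        using proj_works[OF R, of y] by (auto simp: z_def)
      then have "cinner (?B z) z = 0" .
      then have "T z = 0"
        by (simp add: cinner_adj_left[OF T] cinner_self)
      then have "z = 0"
        using expansive[of z] by simp
      then show ?thesis
        using proj_in[OF R, of y] by (simp add: z_def)
    qed
    then show ?thesis by blast
  qed
  ultimately show ?thesis
    by (simp add: bij_def)
qed

lemma T_adj_T_G: "T_adj (T (G x)) = x"
  unfolding G_def using surj_f_inv_f[OF bij_is_surj[OF bij_T_adj_T], of x] by simp

lemma G_T_adj_T: "G (T_adj (T x)) = x"
  unfolding G_def using inv_f_f[OF bij_is_inj[OF bij_T_adj_T], of x] by simp

lemma G_A_G: "G x + A (G x) = x"
  using T_adj_T_G[of x] by (simp add: T_adj_T)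

lemma norm_G: "norm (G x) \<le> norm x"
  using norm_T_adj_T[of "G x"] by (simp add: T_adj_T_G)

lemma bG: "bounded_clinear G"
proof -
  have "G (x + y) = G x + G y" for x y
    using G_T_adj_T[of "G x + G y"] by (simp add: bcl_add[OF T] bcl_add[OF bT_adj] T_adj_T_G)
  moreover have "G (scaleC a x) = scaleC a (G x)" for a x
    using G_T_adj_T[of "scaleC a (G x)"] by (simp add: bcl_scaleC[OF T] bcl_scaleC[OF bT_adj] T_adj_T_G)
  ultimately show ?thesis
    unfolding bounded_clinear_def clinear_def using norm_G by (metis mult.right_neutral)
qed

lemma G_sa: "cinner (G x) y = cinner x (G y)"
proof -
  have "cinner (G x) y = cinner (G x) (T_adj (T (G y)))"
    by (simp add: T_adj_T_G)
  also have "\<dots> = cinner (T_adj (T (G x))) (G y)"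
    by (simp only: cinner_adj[OF T] cinner_adj_left[OF T])
  finally show ?thesis
    by (simp add: T_adj_T_G)
qed

text \<open>Commuting with \<open>A\<close> means commuting with I + A = T^* T, hence with its
  inverse.\<close>

lemma G_commute:
  assumes F: "bounded_clinear F" and "\<And>x. F (A x) = A (F x)"
  shows "F (G x) = G (F x)"
proof -
  have "F (G x) = G (T_adj (T (F (G x))))"
    by (simp add: G_T_adj_T)
  also have "T_adj (T (F (G x))) = F (G x + A (G x))"
    by (simp add: T_adj_T bcl_add[OF F] assms(2))
  finally show ?thesis
    by (simp only: G_A_G)
qed

lemma G_A: "G (A x) = A (G x)"
  using G_commute[OF A] by simp

lemma W_G: "W (G x) = G (W x)"
  by (rule G_commute[OF bW W_A])

lemma V_G: "V (G x) = G (V x)"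
  by (rule G_commute[OF bV V_A])

lemma P_G: "P (G x) = G (P x)"
  by (rule G_commute[OF bP]) simp

lemma G_in: "x \<in> M \<Longrightarrow> G x \<in> M"
  by (metis P_G P_ident P_in)

lemma G_eq_0: "G x = 0 \<Longrightarrow> x = 0"
  using G_A_G[of x] bcl_zero[OF A] by simp

lemma A_G_eq_0: "P x = x \<Longrightarrow> A (G x) = 0 \<Longrightarrow> x = 0"
  using A_inj_on_M[of "G x"] P_G[of x] G_eq_0[of x] by simp

lemmas op_add = bcl_add[OF A] bcl_add[OF bW] bcl_add[OF bV] bcl_add[OF bG] bcl_add[OF bP]
lemmas op_diff = bcl_diff[OF A] bcl_diff[OF bW] bcl_diff[OF bV] bcl_diff[OF bG] bcl_diff[OF bP]
lemmas op_commute = W_A V_A G_A W_G V_G P_G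

subsection \<open>Quasinormality of the compression\<close>

text \<open>Quasinormality of \<open>W\<close> on the whole space, the common form to which all six
  conditions are reduced.\<close>

definition QN :: bool where "QN \<longleftrightarrow> (\<forall>x. W (V (W x)) = V (W (W x)))"

lemma QN_iff_on_M: "QN \<longleftrightarrow> (\<forall>x\<in>M. W (V (W x)) = V (W (W x)))"
  unfolding QN_def using P_in W_P by metis

lemma quasinormal_compression_iff: "quasinormal_on M (\<lambda>x. P (T x)) \<longleftrightarrow> QN"
  unfolding quasinormal_on_def adj_on_compression[OF T]
  unfolding QN_iff_on_M V_def[symmetric] W_def[symmetric] by simp

text \<open>The square of the corner of \<open>T\<close> from \<open>M\<close> to the kernel: the
  full T^* T = I + A minus the part V W of the compression.\<close>

lemma off_diagonal_square:
  assumes "x \<in> M"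
  shows "P (T_adj (T x - P (T x))) = x + A x - V (W x)"
proof -
  have "T_adj (T x - P (T x)) = x + A x - V (W x)"
    by (simp add: bcl_diff[OF bT_adj] T_adj_T W_def V_def)
  then show ?thesis
    using assms by (simp add: op_add op_diff P_ident)
qed

text \<open>On \<open>M\<close> the operator in question is I + A - V W, and \<open>W\<close>
  commutes with I + A, so only commutation with V W remains.\<close>

lemma commute_off_diagonal_iff:
  "(\<forall>x\<in>M. P (T (adj_on M (\<lambda>x. proj (ker_op A) (T x)) (proj (ker_op A) (T x))))
      = adj_on M (\<lambda>x. proj (ker_op A) (T x)) (proj (ker_op A) (T (P (T x))))) \<longleftrightarrow> QN"
proof -
  have Z: "adj_on M (\<lambda>x. proj (ker_op A) (T x)) (proj (ker_op A) (T x)) = x + A x - V (W x)"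
    if "x \<in> M" for x
    unfolding adj_on_compression_ker[OF T]
    unfolding proj_ker using that by (simp add: op_diff off_diagonal_square)
  show ?thesis
    unfolding QN_iff_on_M
    by (intro ball_cong refl) (simp add: Z P_in W_in flip: W_def, simp add: op_add op_diff op_commute)
qed

subsection \<open>The Cauchy dual\<close>

abbreviation "C \<equiv> cauchy_dual T"

lemma cauchy_dual_eq: "C = (\<lambda>x. T (G x))"
  by (simp add: cauchy_dual_def G_def)

lemma C_apply: "C x = T (G x)"
  by (simp add: cauchy_dual_eq)

lemma bC: "bounded_clinear C"
  unfolding cauchy_dual_eq by (rule bounded_clinear_compose[OF T bG])

lemma adj_C: "adj C = (\<lambda>x. G (T_adj x))"
  by (rule adj_eqI) (simp add: cauchy_dual_eq cinner_adj_left[OF T] G_sa[symmetric] cinner_adj[OF T])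

lemma norm_C: "norm (C x) \<le> norm x"
proof -
  have "(norm (C x))\<^sup>2 = Re (cinner (G x) (T_adj (T (G x))))"
    by (simp add: cauchy_dual_eq cinner_adj[OF T] cinner_self)
  also have "\<dots> \<le> norm (G x) * norm x"
    using Re_cinner_le[of "G x" x] by (simp only: T_adj_T_G)
  also have "\<dots> \<le> (norm x)\<^sup>2"
    using norm_G[of x] by (simp add: power2_eq_square mult_right_mono)
  finally show ?thesis
    by (simp add: power2_le_iff_abs_le)
qed

lemma P_C: "P (C x) = W (G x)"
  by (simp add: cauchy_dual_eq W_def)

lemma P_adj_C: "P (adj C (P y)) = G (V y)"
  using P_G by (simp add: adj_C V_def[symmetric])

text \<open>The compression of the dual is W G with adjoint G V. As \<open>G\<close> commutes with
  everything, the defect of quasinormality is G^3 times that of \<open>W\<close>, and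
  \<open>G\<close> is injective.\<close>

lemma quasinormal_dual_iff: "quasinormal_on M (\<lambda>x. P (C x)) \<longleftrightarrow> QN"
proof -
  have "W (G (G (V (W (G x))))) = G (V (W (G (W (G x))))) \<longleftrightarrow> W (V (W x)) = V (W (W x))" for x
  proof -
    have "W (G (G (V (W (G x))))) - G (V (W (G (W (G x))))) = G (G (G (W (V (W x)) - V (W (W x)))))"
      by (simp add: op_diff op_commute)
    then show ?thesis
      using G_eq_0 bcl_zero[OF bG] by (metis eq_iff_diff_eq_0)
  qed
  then show ?thesis
    unfolding quasinormal_on_def adj_on_compression[OF bC]
    unfolding P_adj_C P_C QN_iff_on_M by simp
qed

text \<open>Here the corner square is G (I - V W G) on \<open>M\<close>, and its commutator with W G
  is again, up to sign, G^3 times the quasinormality defect of \<open>W\<close>.\<close>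

lemma commute_dual_off_diagonal_iff:
  "(\<forall>x\<in>M. P (C (adj_on M (\<lambda>x. proj (ker_op A) (C x)) (proj (ker_op A) (C x))))
      = adj_on M (\<lambda>x. proj (ker_op A) (C x)) (proj (ker_op A) (C (P (C x))))) \<longleftrightarrow> QN"
proof -
  have Z: "adj_on M (\<lambda>x. proj (ker_op A) (C x)) (proj (ker_op A) (C x))
      = G (G x + A (G x) - V (W (G x)))" if "x \<in> M" for x
    unfolding adj_on_compression_ker[OF bC]
    unfolding proj_ker off_diagonal_square[OF G_in[OF that], symmetric]
    by (simp add: op_diff adj_C C_apply P_G)
  have "W (G (G (x - V (W (G x))))) = G (W (G x) - V (W (G (W (G x))))) \<longleftrightarrow> W (V (W x)) = V (W (W x))" for x
  proof -
    have "W (G (G (x - V (W (G x))))) - G (W (G x) - V (W (G (W (G x)))))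
        = G (G (G (V (W (W x)) - W (V (W x)))))"
      by (simp add: op_diff op_commute)
    then show ?thesis
      using G_eq_0 bcl_zero[OF bG] by (metis eq_iff_diff_eq_0)
  qed
  then show ?thesis
    unfolding QN_iff_on_M
    by (intro ball_cong refl) (simp add: Z P_C W_in G_A_G)
qed

text \<open>The relations T^* T G = I, G = I - A G and T^* A = A V eliminate \<open>T\<close>,
  giving the factorisation A G (I + G^2 V W).\<close>

lemma DC2_dual_square: "DC2 (C ^^ 2) x = A (G x) + A (G (G (G (V (W x)))))"
proof -
  have "adj (C ^^ 2) y = G (T_adj (G (T_adj y)))" for y
    using adj_compose[OF bC bC] by (simp add: numeral_2_eq_2 o_def adj_C)
  then have "DC2 (C ^^ 2) x = x - G (T_adj (G (T_adj (T (G (T (G x)))))))"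
    by (simp add: DC2_def numeral_2_eq_2 cauchy_dual_eq)
  also have "G (T_adj (T (G (T (G x))))) = T (G x) - A (G (T (G x)))"
    using G_A_G[of "T (G x)"] by (simp only: T_adj_T_G) (metis add_diff_cancel_right')
  also have "A (G (T (G x))) = A (G (G (W x)))"
    by (simp add: G_A[symmetric] A_T W_G)
  also have "x - G (T_adj (T (G x) - A (G (G (W x))))) = x - G x + G (A (V (G (G (W x)))))"
    by (simp add: bcl_diff[OF bT_adj] T_adj_T_G T_adj_A op_diff)
  also have "x - G x = A (G x)"
    using G_A_G[of x] by (metis add_diff_cancel_left')
  finally show ?thesis
    by (simp add: op_commute)
qed

section \<open>Regularity of the Cauchy dual for its squared defect\<close>

abbreviation "D \<equiv> DC2 (C ^^ 2)"

lemma bD: "bounded_clinear D"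
  unfolding DC2_def
  by (intro bounded_clinear_diff bounded_clinear_ident
      bounded_clinear_compose[OF bounded_clinear_adj[OF bounded_clinear_funpow[OF bC]] bounded_clinear_funpow[OF bC]])

lemma positive_D: "positive_op D"
proof -
  have "norm ((C ^^ 2) x) \<le> norm x" for x
    using norm_C[of x] norm_C[of "C x"] by (simp add: numeral_2_eq_2)
  then show ?thesis
    by (simp add: positive_op_def DC2_def cinner_diff_right cinner_adj[OF bounded_clinear_funpow[OF bC]]
        cinner_self power_mono flip: of_real_power)
qed

lemma D_T: "D (T x) = D (W x)"
  by (simp add: DC2_dual_square W_T G_A[symmetric] A_T)

text \<open>A G is injective on \<open>M\<close>, and the form of I + G^2 V W at \<open>y\<close> is
  the sum of the squared norms of \<open>y\<close> and \<open>W (G y)\<close>.\<close>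

lemma D_inj_on_M:
  assumes "P y = y" "D y = 0"
  shows "y = 0"
proof -
  have "A (G (y + G (G (V (W y))))) = 0"
    using assms(2) by (simp add: DC2_dual_square op_add)
  moreover have "P (y + G (G (V (W y)))) = y + G (G (V (W y)))"
    by (simp add: op_add op_commute assms(1))
  ultimately have "y + G (G (V (W y))) = 0"
    using A_G_eq_0 by blast
  then have "Re (cinner y (y + G (G (V (W y))))) = 0"
    by simp
  moreover have "cinner y (G (G (V (W y)))) = cinner (W (G y)) (W (G y))"
    by (simp add: G_sa[symmetric] cinner_V W_G)
  ultimately have "(norm y)\<^sup>2 + (norm (W (G y)))\<^sup>2 = 0"
    by (simp add: cinner_add_right cinner_self)
  then show ?thesis
    by (simp add: add_nonneg_eq_0_iff)
qed

lemma regular_dual_iff: "A_regular D C \<longleftrightarrow> QN"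
proof -
  have "D (D (C x)) = D (C (D x)) \<longleftrightarrow> W (V (W x)) = V (W (W x))" for x
  proof -
    let ?q = "V (W (W x)) - W (V (W x))"
    let ?z = "D (W (G x)) - W (G (D x))"
    \<comment> \<open>The terms A G^2 W of the two products cancel; \<open>D\<close> can then be
      dropped because this difference lies in \<open>M\<close>.\<close>
    have z: "?z = A (G (G (G (G ?q))))"
      by (simp add: DC2_dual_square op_add op_diff op_commute)
    have "D (D (C x)) = D (C (D x)) \<longleftrightarrow> D ?z = 0"
      by (simp add: C_apply D_T bcl_diff[OF bD])
    also have "\<dots> \<longleftrightarrow> ?z = 0"
      using D_inj_on_M[of ?z] bcl_zero[OF bD] by (metis z P_A)
    also have "\<dots> \<longleftrightarrow> ?q = 0"
    proof
      assume "?z = 0"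
      then have "A (G (G (G (G ?q)))) = 0" by (simp only: z)
      moreover have "P (G (G (G ?q))) = G (G (G ?q))"
        by (simp add: op_diff op_commute)
      ultimately show "?q = 0"
        using A_G_eq_0 G_eq_0 by blast
    next
      assume "?q = 0"
      then show "?z = 0"
        by (simp only: z bcl_zero[OF bG] bcl_zero[OF A])
    qed
    finally show ?thesis by auto
  qed
  then show ?thesis
    by (simp add: A_regular_iff[OF bD positive_D bC] QN_def)
qed

lemma contraction_regular_dual_iff: "A_contraction D C \<and> A_regular D C \<longleftrightarrow> QN"
  using A_regular_imp_A_contraction[OF bD positive_D bC norm_C] regular_dual_iff by blast

subsection \<open>Powers\<close>

lemmas expansive_funpow = norm_le_norm_funpow[OF expansive]

lemmas bT_funpow = bounded_clinear_funpow[OF T]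
lemmas A_regular_funpow_iff =
  A_regular_iff[OF bounded_clinear_Delta[OF bT_funpow] positive_op_Delta[OF bT_funpow expansive_funpow] bT_funpow]

text \<open>Insert and subtract T^* T in the defect of the power: one copy leaves \<open>A\<close>,
  the other conjugates the lower defect by \<open>T\<close>.\<close>

lemma Delta_funpow_Suc: "Delta (T ^^ Suc m) x = A x + T_adj (Delta (T ^^ m) (T x))"
proof -
  have "adj (T ^^ Suc m) = (\<lambda>x. T_adj (adj (T ^^ m) x))"
    using adj_compose[OF bT_funpow[of m] T] by (simp add: funpow_Suc_right o_def del: funpow.simps)
  then show ?thesis
    by (simp add: Delta_def bcl_diff[OF bT_adj] funpow_swap1)
qed

text \<open>Simultaneous induction: the three facts turn the recursion into A + V W E, with E the
  previous defect, and \<open>QN\<close> makes this commute with \<open>W\<close> again.\<close>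

lemma Delta_funpow_structure:
  assumes QN
  shows "P (Delta (T ^^ m) x) = Delta (T ^^ m) x" "Delta (T ^^ m) (P x) = Delta (T ^^ m) x"
    "Delta (T ^^ m) (W x) = W (Delta (T ^^ m) x)"
proof -
  have "P (Delta (T ^^ m) x) = Delta (T ^^ m) x \<and> Delta (T ^^ m) (P x) = Delta (T ^^ m) x \<and>
    Delta (T ^^ m) (W x) = W (Delta (T ^^ m) x)" for x
  proof (induction m arbitrary: x)
    case 0
    have "adj (T ^^ 0) = (\<lambda>x. x)"
      by (rule adj_eqI) simp
    then have "Delta (T ^^ 0) x = 0" for x
      by (simp only: Delta_def funpow_0 diff_self)
    then show ?case
      by (simp only: bcl_zero[OF bP] bcl_zero[OF bW])
  next
    case (Suc m)
    let ?E = "Delta (T ^^ m)"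
    have "Delta (T ^^ Suc m) x = A x + V (W (?E x))" for x
    proof -
      have "?E (T x) = W (?E x)"
        using Suc by (metis W_def)
      moreover have "T_adj (W (?E x)) = V (W (?E x))"
        by (simp add: V_def)
      ultimately show ?thesis
        by (simp only: Delta_funpow_Suc)
    qed
    then show ?case
      using Suc assms by (simp add: op_add W_A QN_def del: funpow.simps)
  qed
  then show "P (Delta (T ^^ m) x) = Delta (T ^^ m) x" "Delta (T ^^ m) (P x) = Delta (T ^^ m) x"
    "Delta (T ^^ m) (W x) = W (Delta (T ^^ m) x)"
    by blast+
qed

text \<open>With E the defect, E T^n = W^n E and E W = W E, so both E^2 T^n and E T^n E equal W^n
  E^2.\<close>

lemma regular_funpow:
  assumes QN
  shows "A_regular (Delta (T ^^ m)) (T ^^ n)"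
proof -
  let ?E = "Delta (T ^^ m)"
  note E = Delta_funpow_structure[OF assms, of m]
  have ET: "?E ((T ^^ n) x) = (W ^^ n) (?E x)" for n x
  proof (induction n)
    case (Suc n)
    have "?E (T ((T ^^ n) x)) = W (?E ((T ^^ n) x))"
      by (metis E(2,3) W_def)
    then show ?case using Suc by simp
  qed simp
  have EW: "?E ((W ^^ n) x) = (W ^^ n) (?E x)" for n x
    by (induction n) (simp_all add: E(3))
  show ?thesis
    by (simp add: A_regular_funpow_iff ET EW)
qed

text \<open>Here E = A (I + V W), and its commutator with \<open>W\<close> is \<open>A\<close> times
  the quasinormality defect. Regularity places this in the kernel of E, which is contained in the
  kernel of \<open>A\<close>.\<close>

lemma regular_square_imp_QN:
  assumes "A_regular (Delta (T ^^ 2)) (T ^^ 1)"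
  shows QN
  unfolding QN_def
proof
  fix x
  let ?E = "Delta (T ^^ 2)"
  have E: "?E x = A x + A (V (W x))" for x
  proof -
    have "?E x = A x + T_adj (A (T x))"
      using Delta_funpow_Suc[of 1 x] by (simp add: numeral_2_eq_2 o_def)
    then show ?thesis
      by (simp add: T_adj_A V_T)
  qed
  have ET: "?E (T x) = ?E (W x)" for x
    by (simp add: E A_T W_T)
  define q where "q = V (W (W x)) - W (V (W x))"
  have z: "?E (W x) - W (?E x) = A q"
    by (simp add: E q_def op_add op_diff op_commute)
  have "?E (?E (T x)) = ?E (T (?E x))"
    using assms A_regular_funpow_iff[of 2 1] by simp
  then have "?E (?E (W x) - W (?E x)) = 0"
    by (simp add: ET bcl_diff[OF bounded_clinear_Delta[OF bT_funpow]])
  then have "norm ((T ^^ 2) (A q)) = norm (A q)"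
    by (simp only: z Delta_eq_0_iff[OF bT_funpow expansive_funpow])
  then have "norm (T (A q)) = norm (A q)"
    using expansive[of "A q"] expansive[of "T (A q)"] by (simp add: numeral_2_eq_2)
  then have "A (A q) = 0"
    by (simp add: Delta_eq_0_iff[OF T expansive])
  then have "A q = 0"
    by (rule A_A_eq_0)
  moreover have "P q = q"
    by (simp add: q_def op_diff)
  ultimately show "W (V (W x)) = V (W (W x))"
    using A_inj_on_M[of q] by (simp add: q_def)
qed

lemma regular_funpow_iff:
  "(\<forall>m n. m \<ge> 1 \<and> n \<ge> 1 \<longrightarrow> A_regular (Delta (T ^^ m)) (T ^^ n)) \<longleftrightarrow> QN"
proof
  assume "\<forall>m n. m \<ge> 1 \<and> n \<ge> 1 \<longrightarrow> A_regular (Delta (T ^^ m)) (T ^^ n)"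
  then have "A_regular (Delta (T ^^ 2)) (T ^^ 1)"
    by (meson one_le_numeral order_refl)
  then show QN
    by (rule regular_square_imp_QN)
qed (simp add: regular_funpow)

end

theorem theorem4p1:
  fixes T :: "'a::complex_hilbert \<Rightarrow> 'a"
  assumes "bounded_clinear T" and "concave_op T"
  shows "(\<forall>m n. m \<ge> 1 \<and> n \<ge> 1 \<longrightarrow>
            A_contraction (Delta (T ^^ m)) (T ^^ n) \<and> ker_op (Delta T) = ker_op (Delta (T ^^ n)))
    \<and> (A_regular (Delta T) T \<longrightarrow>
        (let M = closure (range (Delta T)); N = ker_op (Delta T);
             Th = (\<lambda>x. proj M (T x)); Zh = (\<lambda>x. proj N (T x));
             T' = cauchy_dual T;
             T0 = (\<lambda>x. proj M (T' x)); T1 = (\<lambda>x. proj N (T' x));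
             i = (\<forall>m n. m \<ge> 1 \<and> n \<ge> 1 \<longrightarrow> A_regular (Delta (T ^^ m)) (T ^^ n));
             ii = quasinormal_on M Th;
             iii = (\<forall>x\<in>M. Th (adj_on M Zh (Zh x)) = adj_on M Zh (Zh (Th x)));
             iv = (A_contraction (DC2 (T' ^^ 2)) T' \<and> A_regular (DC2 (T' ^^ 2)) T');
             v = quasinormal_on M T0;
             vi = (\<forall>x\<in>M. T0 (adj_on M T1 (T1 x)) = adj_on M T1 (T1 (T0 x)))
         in (i \<longleftrightarrow> ii) \<and> (i \<longleftrightarrow> iii) \<and> (i \<longleftrightarrow> iv) \<and> (i \<longleftrightarrow> v) \<and> (i \<longleftrightarrow> vi)))"
proof -
  interpret c: concave T
    by unfold_locales (fact assms)+
  \<comment> \<open>Regularity is an assumption of the locale \<open>expansive_regular\<close>, so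
    that locale is entered only in the second case.\<close>
  have ?thesis if "\<not> A_regular (Delta T) T"
    using that c.A_contraction_funpow c.ker_Delta_funpow by simp
  moreover have ?thesis if "A_regular (Delta T) T"
  proof -
    interpret r: expansive_regular T
      by unfold_locales (fact assms(1) c.expansive that)+
    show ?thesis
      \<comment> \<open>Each of the six conditions is rewritten to \<open>QN\<close>, which makes
        the equivalences trivial.\<close>
      unfolding Let_def r.regular_funpow_iff r.quasinormal_compression_iff r.commute_off_diagonal_iff
        r.contraction_regular_dual_iff r.quasinormal_dual_iff r.commute_dual_off_diagonal_iff
      using c.A_contraction_funpow c.ker_Delta_funpow by simp
  qed
  ultimately show ?thesis by blast
qed

end
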